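(* For every $0<p,q\leq+\infty$ and every $\tau\in\mathbb{R}$, the Besov space $B_{p,q}^{\tau}(\mathbb{T}^d)$ is a measurable subset of $\mathcal{S}'(\mathbb{T}^d)$ for the cylindrical $\sigma$-field, i.e. $$B_{p,q}^{\tau}(\mathbb{T}^d)\in\mathcal{B}_c(\mathcal{S}'(\mathbb{T}^d)).$$
   Context: $\mathbb{T}^d=\mathbb{R}^d/\mathbb{Z}^d$. $\mathcal{S}(\mathbb{T}^d)$ is the space of smooth periodic (real-valued) functions with its usual nuclear Fréchet topology, $\mathcal{S}'(\mathbb{T}^d)$ is its topological dual (periodic generalized functions), and $\langle u,\varphi\rangle$ is the duality product, linear in both arguments (extended by linearity to complex-valued test functions). Cylindrical $\sigma$-field: $\mathcal{B}_c(\mathcal{S}'(\mathbb{T}^d))$ is the $\sigma$-field on $\mathcal{S}'(\mathbb{T}^d)$ generated by the sets $\{u\in\mathcal{S}'(\mathbb{T}^d) : (\langle u,\varphi_1\rangle,\dots,\langle u,\varphi_N\rangle)\in B\}$ with $N\in\mathbb{N}$, $\varphi_1,\dots,\varphi_N\in\mathcal{S}(\mathbb{T}^d)$ and $B\subset\mathbb{R}^N$ Borel. Wavelets: for $u\in\mathbb{N}$, a wavelet system of regularity $u$ is obtained from real compactly supported $\psi_F,\psi_M\in C^u(\mathbb{R})$ (scaling function and orthonormal Daubechies-type wavelet, $\psi_M$ having vanishing moments up to order $u-1$). $G^0=\{F,M\}^d$ and, for $j\geq1$, $G^j$ is the set of $G\in\{F,M\}^d$ with at least one component equal to $M$. $L\in\mathbb{N}$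 is fixed large enough that the scale-$0$ wavelets are supported within the torus, $\mathbb{P}_j^d=\{m\in\mathbb{Z}^d : 0\leq m_k<2^{j+L},\ 1\leq k\leq d\}$, and $\Psi_{G,m}^{j,\mathrm{per}}$ is the $\mathbb{Z}^d$-periodization of $2^{(j+L)d/2}\prod_{a=1}^d\psi_{G_a}(2^{j+L}x_a-m_a)$. The family $\{\Psi_{G,m}^{j,\mathrm{per}} : j\in\mathbb{N}_0,\ G\in G^j,\ m\in\mathbb{P}_j^d\}$ is an orthonormal basis of $L_2(\mathbb{T}^d)$. Besov sequence spaces: $b_{p,q}^{\tau,\mathrm{per}}$ is the set of sequences $\lambda=(\lambda_m^{j,G})_{j\in\mathbb{N}_0,G\in G^j,m\in\mathbb{P}_j^d}$ of complex numbers with $$\|\lambda\|_{b_{p,q}^{\tau,\mathrm{per}}}=\Big(\sum_{j\geq0}2^{j(\tau-d/p)q}\sum_{G\in G^j}\Big(\sum_{m\in\mathbb{P}_j^d}|\lambda_m^{j,G}|^p\Big)^{q/p}\Big)^{1/q}<\infty$$ (usual supremum modifications if $p=\infty$ or $q=\infty$; $1/\infty=0$). Besov spaces: $B_{p,q}^{\tau}(\mathbb{T}^d)$ is the usual periodic Besov space, equivalently (with $(x)_+=\max(x,0)$): choosing a wavelet system of regularity $u>\max(\tau,d(1/p-1)_+-\tau)$, it is the set of $f\in\mathcal{S}'(\mathbb{T}^d)$ that can be written $f=\sum_{j,G,m}\lambda_m^{j,G}2^{-(j+L)d/2}\Psi_{G,m}^{j,\mathrm{per}}$ with $\lambda\in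 b_{p,q}^{\tau,\mathrm{per}}$ (unconditional convergence in $\mathcal{S}'(\mathbb{T}^d)$); the representation is unique and the space does not depend on the choice of wavelet system. *)

theory Defs
  imports "HOL-Analysis.Analysis"
begin

section \<open>Periodic test functions and periodic generalized functions\<close>

text \<open>
  The torus of dimension \<open>d = CARD('n)\<close> is handled through functions on \<open>real ^ 'n\<close> that are
  invariant under integer translations.
\<close>

definition int_vec :: "int ^ 'n \<Rightarrow> real ^ 'n" where
  "int_vec k = (\<chi> a. of_int (k $ a))"

fun iter_partial :: "'n::finite list \<Rightarrow> (real ^ 'n \<Rightarrow> real) \<Rightarrow> real ^ 'n \<Rightarrow> real" where
  "iter_partial [] f = f"
| "iter_partial (i # is) f = (\<lambda>x. frechet_derivative (iter_partial is f) (at x) (axis i 1))"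

definition smooth :: "(real ^ 'n::finite \<Rightarrow> real) \<Rightarrow> bool" where
  "smooth f \<longleftrightarrow> (\<forall>is x. iter_partial is f differentiable (at x))"

definition test_functions :: "(real ^ 'n::finite \<Rightarrow> real) set" where
  "test_functions = {\<phi>. smooth \<phi> \<and> (\<forall>k x. \<phi> (x + int_vec k) = \<phi> x)}"

text \<open>
  The Frechet topology is the one generated by the open balls of all the seminorms
  \<open>\<phi> \<mapsto> sup \<bar>\<partial>\<^sup>\<alpha> \<phi>\<bar>\<close>; the suprema are finite by periodicity.
\<close>

definition test_topology :: "(real ^ 'n::finite \<Rightarrow> real) topology" where
  "test_topology = topology_generated_by
     {{\<psi> \<in> test_functions. (SUP x. \<bar>iter_partial is (\<lambda>y. \<psi> y - \<phi> y) x\<bar>) < \<epsilon>} | is \<phi> \<epsilon>.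
        \<phi> \<in> test_functions \<and> 0 < \<epsilon>}"

text \<open>
  A generalized function is a functional defined on test functions only; requiring it to be
  extensional makes HOL equality coincide with equality in the dual space.
\<close>

definition gen_functions :: "((real ^ 'n::finite \<Rightarrow> real) \<Rightarrow> real) set" where
  "gen_functions = {f \<in> extensional test_functions.
     (\<forall>\<phi>\<in>test_functions. \<forall>\<psi>\<in>test_functions. f (\<lambda>x. \<phi> x + \<psi> x) = f \<phi> + f \<psi>) \<and>
     (\<forall>c. \<forall>\<phi>\<in>test_functions. f (\<lambda>x. c * \<phi> x) = c * f \<phi>) \<and>
     continuous_map test_topology euclideanreal f}"

text \<open>
  \<open>\<real>\<^sup>N\<close> is the space of extensional functions on \<open>{..<N}\<close>; the product of \<open>N\<close> copies of
  \<open>borel\<close> is its Borel \<open>\<sigma>\<close>-algebra.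
\<close>

definition cylindrical_field :: "((real ^ 'n::finite \<Rightarrow> real) \<Rightarrow> real) set set" where
  "cylindrical_field = sigma_sets gen_functions
     {{f \<in> gen_functions. (\<lambda>i\<in>{..<N}. f (\<phi> i)) \<in> B} | N \<phi> B.
        (\<forall>i<N. \<phi> i \<in> test_functions) \<and> B \<in> sets (\<Pi>\<^sub>M i\<in>{..<N::nat}. (borel :: real measure))}"


section \<open>Wavelet systems\<close>

datatype gender = F | M

definition line_wavelet :: "(gender \<Rightarrow> real \<Rightarrow> real) \<Rightarrow> nat \<Rightarrow> gender \<Rightarrow> int \<Rightarrow> real \<Rightarrow> real" where
  "line_wavelet \<psi> j K m x = 2 powr (real j / 2) * \<psi> K (2 ^ j * x - of_int m)"

definition line_index :: "(nat \<times> gender \<times> int) set" where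
  "line_index = {(j, K, m). j = 0 \<or> K = M}"

text \<open>
  \<open>\<psi> F\<close> is the scaling function and \<open>\<psi> M\<close> the wavelet. The fourth condition is the two-scale
  relation (a finite one, the supports being compact). The last two conditions say that the
  translates of \<open>\<psi> F\<close> together with the dilated translates of \<open>\<psi> M\<close> at the scales \<open>j \<ge> 0\<close> form
  an orthonormal basis of \<open>L\<^sub>2(\<real>)\<close>.
\<close>

definition wavelet_system :: "nat \<Rightarrow> (gender \<Rightarrow> real \<Rightarrow> real) \<Rightarrow> bool" where
  "wavelet_system u \<psi> \<longleftrightarrow>
     (\<forall>K. compact (closure {x. \<psi> K x \<noteq> 0})) \<and>
     (\<forall>K. (\<forall>k<u. \<forall>x. (deriv ^^ k) (\<psi> K) field_differentiable (at x)) \<and>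
          continuous_on UNIV ((deriv ^^ u) (\<psi> K))) \<and>
     (\<forall>k<u. (LINT x|lborel. x ^ k * \<psi> M x) = 0) \<and>
     (\<forall>K. \<exists>h :: int \<Rightarrow> real. finite {k. h k \<noteq> 0} \<and>
          (\<forall>x. \<psi> K x = (\<Sum>k | h k \<noteq> 0. h k * \<psi> F (2 * x - of_int k)))) \<and>
     (\<forall>(j, K, m) \<in> line_index. \<forall>(j', K', m') \<in> line_index.
        (LINT x|lborel. line_wavelet \<psi> j K m x * line_wavelet \<psi> j' K' m' x)
          = (if (j, K, m) = (j', K', m') then 1 else 0)) \<and>
     (\<forall>g \<in> borel_measurable lborel. integrable lborel (\<lambda>x. (g x)\<^sup>2) \<longrightarrow>
        (\<forall>(j, K, m) \<in> line_index. (LINT x|lborel. g x * line_wavelet \<psi> j K m x) = 0) \<longrightarrow>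
        (AE x in lborel. g x = 0))"

definition torus_types :: "nat \<Rightarrow> ('n \<Rightarrow> gender) set" where
  "torus_types j = (if j = 0 then UNIV else {G. \<exists>a. G a = M})"

definition torus_positions :: "nat \<Rightarrow> nat \<Rightarrow> (int ^ 'n) set" where
  "torus_positions L j = {m. \<forall>a. 0 \<le> m $ a \<and> m $ a < 2 ^ (j + L)}"

definition torus_index :: "nat \<Rightarrow> (nat \<times> ('n \<Rightarrow> gender) \<times> (int ^ 'n)) set" where
  "torus_index L = {(j, G, m). G \<in> torus_types j \<and> m \<in> torus_positions L j}"

definition wavelet :: "(gender \<Rightarrow> real \<Rightarrow> real) \<Rightarrow> nat \<Rightarrow> nat \<Rightarrow> ('n::finite \<Rightarrow> gender) \<Rightarrow>
    int ^ 'n \<Rightarrow> real ^ 'n \<Rightarrow> real" where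
  "wavelet \<psi> L j G m x = 2 powr (real (j + L) * real CARD('n) / 2) *
     (\<Prod>a\<in>UNIV. \<psi> (G a) (2 ^ (j + L) * x $ a - of_int (m $ a)))"

text \<open>For compactly supported \<open>\<psi>\<close> only finitely many terms of the following sum are nonzero.\<close>

definition per_wavelet :: "(gender \<Rightarrow> real \<Rightarrow> real) \<Rightarrow> nat \<Rightarrow> nat \<Rightarrow> ('n::finite \<Rightarrow> gender) \<Rightarrow>
    int ^ 'n \<Rightarrow> real ^ 'n \<Rightarrow> real" where
  "per_wavelet \<psi> L j G m x = (\<Sum>\<^sub>\<infinity>k. wavelet \<psi> L j G m (x + int_vec k))"

definition wavelet_pairing :: "(gender \<Rightarrow> real \<Rightarrow> real) \<Rightarrow> nat \<Rightarrow> nat \<Rightarrow> ('n::finite \<Rightarrow> gender) \<Rightarrow>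
    int ^ 'n \<Rightarrow> (real ^ 'n \<Rightarrow> real) \<Rightarrow> real" where
  "wavelet_pairing \<psi> L j G m \<phi> = (LINT x:cbox 0 1|lborel. per_wavelet \<psi> L j G m x * \<phi> x)"


section \<open>Besov spaces\<close>

text \<open>
  The parameters \<open>p\<close> and \<open>q\<close> range over the positive elements of \<open>ennreal\<close>; \<open>recip p\<close> is
  \<open>1/p\<close>, with \<open>1/\<infinity> = 0\<close>.
\<close>

definition recip :: "ennreal \<Rightarrow> real" where
  "recip p = enn2real (1 / p)"

text \<open>Only used for positive exponents.\<close>

definition ennreal_powr :: "ennreal \<Rightarrow> real \<Rightarrow> ennreal" where
  "ennreal_powr x r = (if x = \<infinity> then \<infinity> else ennreal (enn2real x powr r))"

definition lp_norm :: "ennreal \<Rightarrow> 'i set \<Rightarrow> ('i \<Rightarrow> complex) \<Rightarrow> ennreal" where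
  "lp_norm p A x =
     (if p = \<infinity> then (SUP i\<in>A. ennreal (cmod (x i)))
      else ennreal_powr (\<Sum>\<^sub>\<infinity>i\<in>A. ennreal (cmod (x i) powr enn2real p)) (recip p))"

definition besov_seq_norm :: "nat \<Rightarrow> ennreal \<Rightarrow> ennreal \<Rightarrow> real \<Rightarrow>
    (nat \<Rightarrow> ('n::finite \<Rightarrow> gender) \<Rightarrow> int ^ 'n \<Rightarrow> complex) \<Rightarrow> ennreal" where
  "besov_seq_norm L p q \<tau> c =
     (let s = \<tau> - real CARD('n) * recip p in
      if q = \<infinity> then
        (SUP j. ennreal (2 powr (real j * s)) *
           (SUP G\<in>torus_types j. lp_norm p (torus_positions L j) (c j G)))
      else
        ennreal_powr
          (\<Sum>j. ennreal (2 powr (real j * s * enn2real q)) *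
             (\<Sum>G\<in>torus_types j.
                ennreal_powr (lp_norm p (torus_positions L j) (c j G)) (enn2real q)))
          (recip q))"

text \<open>
  Unconditional convergence in the space of generalized functions is summability, over the
  unordered index set, of the pairings with every test function. The coefficients are complex,
  as are therefore the pairings.
\<close>

definition besov_space :: "(gender \<Rightarrow> real \<Rightarrow> real) \<Rightarrow> nat \<Rightarrow> ennreal \<Rightarrow> ennreal \<Rightarrow> real \<Rightarrow>
    ((real ^ 'n::finite \<Rightarrow> real) \<Rightarrow> real) set" where
  "besov_space \<psi> L p q \<tau> =
     {f \<in> gen_functions. \<exists>c. besov_seq_norm L p q \<tau> c < \<infinity> \<and>
        (\<forall>\<phi>\<in>test_functions.
           ((\<lambda>(j, G, m). c j G m *
               of_real (2 powr (- (real (j + L) * real CARD('n) / 2)) *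
                        wavelet_pairing \<psi> L j G m \<phi>))
             has_sum of_real (f \<phi>)) (torus_index L))}"

end

theory Submission
  imports Defs
begin

text \<open>
  Wavelets of finite regularity are not test functions, so the wavelet coefficients of a
  generalized function are not cylindrical. Instead, fix a bound \<open>N\<close> on the norm and consider the
  ball \<open>K\<close> of Besov sequences of norm at most \<open>N\<close>, with pointwise convergence. It is compact, and
  the synthesis map from \<open>K\<close> to generalized functions is continuous: by the vanishing moments, the
  pairing of a test function with the wavelets of scale \<open>j\<close> decays fast enough, thanks to
  \<open>u > d (1/p - 1)\<^sub>+ - \<tau>\<close>, for the synthesis series to converge uniformly on \<open>K\<close>. Let \<open>\<phi>\<^sub>i\<close> enumerate
  a countable dense set of test functions and let \<open>C\<close> be a countable dense subset of \<open>K\<close>. By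
  compactness \<open>f\<close> is the synthesis of some element of \<open>K\<close> iff for every \<open>n\<close> some \<open>c \<in> C\<close> satisfies
  \<open>\<bar>f \<phi>\<^sub>i - T c \<phi>\<^sub>i\<bar> < 1 / (n + 1)\<close> for all \<open>i \<le> n\<close>, where \<open>T\<close> is the synthesis map. This is a
  countable combination of cylinder sets, and the Besov space is the union over \<open>N\<close>.
\<close>

section \<open>Test functions\<close>

text \<open>Membership asks for the existence of a coefficient sequence. Projecting along such an
  uncountable choice gives in general only an analytic set; compactness is what makes the choice
  countable. The ball is closed because its norm bound is a conjunction of continuous conditions on
  finitely many coefficients each, and it sits in a product of discs because every level has an l^p
  bound. The index type is countable, so pointwise convergence is metrizable, which supplies
  countable dense subsets and convergent subsequences. The threshold for \<open>u\<close> comes from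
  counting: by Hoelder over \<open>2^((j+L)d)\<close> positions (for p < 1, by the inclusion of l^p
  in l^1) the l^1 norm of level \<open>j\<close> is at most of order
  \<open>2^(j(d + d(1/p-1)_+ - \<tau>))\<close>, while the pairing with a wavelet normalised in sup
  norm is \<open>O(2^(-j(d+u)))\<close>: \<open>d\<close> from the volume of the support,
  \<open>u\<close> from the order of the Taylor remainder. Countably many test functions suffice
  since both sides of the synthesis identity are sequentially continuous in the test
  function.\<close>

lemma iter_partial_differentiable: "smooth f \<Longrightarrow> iter_partial is f differentiable (at x)"
  by (simp add: smooth_def)

lemma iter_partial_has_derivative:
  "smooth f \<Longrightarrow> (iter_partial is f has_derivative frechet_derivative (iter_partial is f) (at x)) (at x)"
  using frechet_derivative_works iter_partial_differentiable by blast

lemma continuous_on_iter_partial: "smooth f \<Longrightarrow> continuous_on A (iter_partial is f)"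
  by (meson continuous_at_imp_continuous_on differentiable_imp_continuous_within
      iter_partial_differentiable)

lemma iter_partial_diff:
  assumes "smooth f" "smooth g"
  shows "iter_partial is (\<lambda>x. f x - g x) = (\<lambda>x. iter_partial is f x - iter_partial is g x)"
proof (induction "is")
  case (Cons i "is")
  show ?case
  proof
    fix x
    have "((\<lambda>x. iter_partial is f x - iter_partial is g x) has_derivative
       (\<lambda>h. frechet_derivative (iter_partial is f) (at x) h - frechet_derivative (iter_partial is g) (at x) h)) (at x)"
      by (intro has_derivative_diff iter_partial_has_derivative assms)
    from frechet_derivative_at[OF this] show
      "iter_partial (i # is) (\<lambda>x. f x - g x) x = iter_partial (i # is) f x - iter_partial (i # is) g x"
      unfolding iter_partial.simps Cons by metis
  qed
qed simp

lemma smooth_diff: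
  assumes "smooth f" "smooth g"
  shows "smooth (\<lambda>x. f x - g x)"
  using assms unfolding smooth_def iter_partial_diff[OF assms]
  by (intro allI differentiable_diff) auto

lemma test_functions_diff:
  "\<phi> \<in> test_functions \<Longrightarrow> \<psi> \<in> test_functions \<Longrightarrow> (\<lambda>x. \<phi> x - \<psi> x) \<in> test_functions"
  by (auto simp: test_functions_def smooth_diff)

lemma test_functions_smooth: "\<phi> \<in> test_functions \<Longrightarrow> smooth \<phi>"
  by (auto simp: test_functions_def)

lemma iter_partial_periodic:
  assumes "\<phi> \<in> test_functions"
  shows "iter_partial is \<phi> (x + int_vec k) = iter_partial is \<phi> x"
proof (induction "is" arbitrary: x)
  case Nil
  then show ?case using assms by (auto simp: test_functions_def)
next
  case (Cons i "is")
  let ?g = "iter_partial is \<phi>"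
  have "(?g \<circ> (\<lambda>y. y + int_vec k) has_derivative
     frechet_derivative ?g (at (x + int_vec k)) \<circ> (\<lambda>h. h)) (at x)"
    by (intro diff_chain_at iter_partial_has_derivative test_functions_smooth assms)
       (auto intro!: derivative_eq_intros)
  moreover have "?g \<circ> (\<lambda>y. y + int_vec k) = ?g"
    using Cons by auto
  ultimately have "(?g has_derivative frechet_derivative ?g (at (x + int_vec k))) (at x)"
    by (simp add: o_def)
  from frechet_derivative_at[OF this] show ?case
    by simp
qed

lemma unit_cube_translate:
  fixes x :: "real ^ 'n::finite"
  obtains k y where "y \<in> cbox 0 1" "x = y + int_vec k"
proof
  show "x - int_vec (\<chi> a. \<lfloor>x $ a\<rfloor>) \<in> cbox 0 1"
    by (auto simp: mem_box_cart int_vec_def algebra_simps) linarith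
qed simp

lemma iter_partial_bounded:
  assumes "\<phi> \<in> test_functions"
  shows "bdd_above (range (\<lambda>x. \<bar>iter_partial is \<phi> x\<bar>))"
proof -
  have "compact (iter_partial is \<phi> ` cbox 0 1)"
    by (intro compact_continuous_image continuous_on_iter_partial test_functions_smooth assms
        compact_cbox)
  then obtain B where B: "\<forall>x\<in>cbox 0 1. \<bar>iter_partial is \<phi> x\<bar> \<le> B"
    using compact_imp_bounded[of "iter_partial is \<phi> ` cbox 0 1"] by (auto simp: bounded_iff)
  have "\<bar>iter_partial is \<phi> x\<bar> \<le> B" for x
    using unit_cube_translate[of x] B iter_partial_periodic[OF assms] by metis
  then show ?thesis by (intro bdd_aboveI2)
qed

text \<open>The seminorms whose balls generate \<open>test_topology\<close>. Without periodicity the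
  supremum may range over an unbounded set and then says nothing, so the facts about it assume
  membership in \<open>test_functions\<close>.\<close>

definition sup_deriv :: "'n list \<Rightarrow> (real ^ 'n::finite \<Rightarrow> real) \<Rightarrow> real" where
  "sup_deriv is \<phi> = (SUP x. \<bar>iter_partial is \<phi> x\<bar>)"

lemma iter_partial_le_sup_deriv:
  "\<phi> \<in> test_functions \<Longrightarrow> \<bar>iter_partial is \<phi> x\<bar> \<le> sup_deriv is \<phi>"
  unfolding sup_deriv_def by (intro cSUP_upper iter_partial_bounded) auto

lemma sup_deriv_nonneg: "\<phi> \<in> test_functions \<Longrightarrow> 0 \<le> sup_deriv is \<phi>"
  using iter_partial_le_sup_deriv[of \<phi> "is" undefined] by linarith

text \<open>
  On a finite net of the unit cube, record the integer parts of the multiples by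
  \<open>n + 1\<close> of all derivatives of order at most \<open>k\<close>. There are countably many such records, and
  functions with the same record and the same modulus of continuity are close.
\<close>

lemma test_functions_countable_approx:
  fixes N n k :: nat
  defines "A \<equiv> {\<phi> \<in> test_functions. \<forall>is::'n::finite list. length is \<le> k \<longrightarrow>
     (\<forall>x\<in>cbox 0 1. \<forall>y\<in>cbox 0 1. dist x y < 1 / real (Suc N) \<longrightarrow>
        \<bar>iter_partial is \<phi> x - iter_partial is \<phi> y\<bar> < 1 / real (Suc n))}"
  shows "\<exists>D. countable D \<and> D \<subseteq> A \<and> (\<forall>\<phi>\<in>A. \<exists>\<psi>\<in>D. \<forall>is. length is \<le> k \<longrightarrow>
     (\<forall>x. \<bar>iter_partial is \<phi> x - iter_partial is \<psi> x\<bar> \<le> 3 / real (Suc n)))"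
proof -
  have "\<exists>G. finite G \<and> G \<subseteq> cbox 0 1 \<and> cbox 0 (1::real^'n) \<subseteq> (\<Union>x\<in>G. ball x (1 / real (Suc N)))"
  proof (rule compactE_image[OF compact_cbox[of 0 "1::real^'n"]])
    show "cbox 0 (1::real^'n) \<subseteq> (\<Union>x\<in>cbox 0 1. ball x (1 / real (Suc N)))"
      by (intro subsetI UN_I) auto
  qed auto
  then obtain G :: "(real^'n) set" where G: "finite G" "G \<subseteq> cbox 0 1"
    "cbox 0 1 \<subseteq> (\<Union>x\<in>G. ball x (1 / real (Suc N)))" by blast
  define Ls where "Ls = {is :: 'n list. length is \<le> k}"
  have "finite Ls"
    unfolding Ls_def using finite_lists_length_le[of "UNIV :: 'n set" k] by simp
  define code where "code \<phi> = (\<lambda>(x, is)\<in>G \<times> Ls. \<lfloor>real (Suc n) * iter_partial is \<phi> x\<rfloor>)"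
    for \<phi> :: "real ^ 'n \<Rightarrow> real"
  have "code ` A \<subseteq> (G \<times> Ls) \<rightarrow>\<^sub>E UNIV"
    unfolding code_def by (intro image_subsetI restrict_PiE_iff[THEN iffD2]) auto
  moreover have "countable ((G \<times> Ls) \<rightarrow>\<^sub>E (UNIV :: int set))"
    by (intro countable_PiE finite_cartesian_product \<open>finite G\<close> \<open>finite Ls\<close>) auto
  ultimately have ctb: "countable (code ` A)"
    by (rule countable_subset)
  \<comment> \<open>One representative per record, chosen inside \<open>A\<close> so that it has the
    same modulus of continuity as the functions it stands for.\<close>
  define D where "D = inv_into A code ` (code ` A)"
  have DA: "D \<subseteq> A"
    unfolding D_def by (auto intro: inv_into_into)
  have "\<exists>\<psi>\<in>D. \<forall>is. length is \<le> k \<longrightarrow>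
     (\<forall>x. \<bar>iter_partial is \<phi> x - iter_partial is \<psi> x\<bar> \<le> 3 / real (Suc n))" if "\<phi> \<in> A" for \<phi>
  proof -
    define \<psi> where "\<psi> = inv_into A code (code \<phi>)"
    have "\<psi> \<in> D" unfolding D_def \<psi>_def using that by auto
    then have "\<psi> \<in> A" using DA by auto
    have eq: "code \<psi> = code \<phi>"
      unfolding \<psi>_def by (rule f_inv_into_f[of "code \<phi>" code A, OF imageI[OF that]])
    \<comment> \<open>Three errors of \<open>1 / (n + 1)\<close>: \<phi> from \<open>y\<close> to a
      net point \<open>g\<close>, \<phi> against \<psi> at \<open>g\<close> (equal floors), and
      \<psi> from \<open>g\<close> back to \<open>y\<close>.\<close>
    have "\<bar>iter_partial is \<phi> x - iter_partial is \<psi> x\<bar> \<le> 3 / real (Suc n)"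
      if len: "length is \<le> k" for "is" x
    proof -
      obtain l y where y: "y \<in> cbox 0 1" "x = y + int_vec l"
        using unit_cube_translate .
      obtain g where g: "g \<in> G" "dist y g < 1 / real (Suc N)"
        using y G by (auto simp: dist_commute)
      have gc: "g \<in> cbox 0 1" using g G by auto
      have 1: "\<bar>iter_partial is \<phi> y - iter_partial is \<phi> g\<bar> < 1 / real (Suc n)"
        using \<open>\<phi> \<in> A\<close> len y(1) gc g(2) unfolding A_def by blast
      have 2: "\<bar>iter_partial is \<psi> y - iter_partial is \<psi> g\<bar> < 1 / real (Suc n)"
        using \<open>\<psi> \<in> A\<close> len y(1) gc g(2) unfolding A_def by blast
      have "(g, is) \<in> G \<times> Ls" using g len by (auto simp: Ls_def)
      then have "\<lfloor>real (Suc n) * iter_partial is \<psi> g\<rfloor> = \<lfloor>real (Suc n) * iter_partial is \<phi> g\<rfloor>"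
        using fun_cong[OF eq, of "(g, is)"] unfolding code_def by simp
      then have "\<bar>real (Suc n) * iter_partial is \<psi> g - real (Suc n) * iter_partial is \<phi> g\<bar> < 1"
        by linarith
      then have "real (Suc n) * \<bar>iter_partial is \<psi> g - iter_partial is \<phi> g\<bar> < 1"
        by (simp add: abs_mult flip: right_diff_distrib)
      then have 3: "\<bar>iter_partial is \<psi> g - iter_partial is \<phi> g\<bar> < 1 / real (Suc n)"
        by (simp add: field_simps)
      have per: "iter_partial is \<phi> x = iter_partial is \<phi> y" "iter_partial is \<psi> x = iter_partial is \<psi> y"
        using \<open>\<phi> \<in> A\<close> \<open>\<psi> \<in> A\<close> by (auto simp: A_def y iter_partial_periodic)
      have "3 / real (Suc n) = 1 / real (Suc n) + 1 / real (Suc n) + 1 / real (Suc n)"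
        by simp
      then show ?thesis using 1 2 3 unfolding per by linarith
    qed
    then show ?thesis using \<open>\<psi> \<in> D\<close> by blast
  qed
  moreover have "countable D" unfolding D_def using ctb by simp
  ultimately show ?thesis using DA by blast
qed

text \<open>By uniform continuity on the cube of the finitely many derivatives of order at most
  \<open>k\<close>, each test function lies in \<open>A N n k\<close> for some \<open>N\<close>, so
  the union of the countable approximating sets is dense. Density is stated through sequences, the
  form in which continuity of functionals is used later.\<close>

lemma test_functions_separable:
  obtains D :: "(real ^ 'n::finite \<Rightarrow> real) set" where "countable D" "D \<subseteq> test_functions"
    "\<And>\<phi>. \<phi> \<in> test_functions \<Longrightarrow>
       \<exists>\<psi>. (\<forall>n::nat. \<psi> n \<in> D) \<and> (\<forall>is. (\<lambda>n. sup_deriv is (\<lambda>x. \<phi> x - \<psi> n x)) \<longlonglongrightarrow> 0)"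
proof -
  define A :: "nat \<Rightarrow> nat \<Rightarrow> nat \<Rightarrow> (real ^ 'n \<Rightarrow> real) set" where
    "A N n k = {\<phi> \<in> test_functions. \<forall>is. length is \<le> k \<longrightarrow>
     (\<forall>x\<in>cbox 0 1. \<forall>y\<in>cbox 0 1. dist x y < 1 / real (Suc N) \<longrightarrow>
        \<bar>iter_partial is \<phi> x - iter_partial is \<phi> y\<bar> < 1 / real (Suc n))}" for N n k
  define Q where "Q N n k D \<longleftrightarrow> countable D \<and> D \<subseteq> A N n k \<and>
     (\<forall>\<phi>\<in>A N n k. \<exists>\<psi>\<in>D. \<forall>is. length is \<le> k \<longrightarrow>
     (\<forall>x. \<bar>iter_partial is \<phi> x - iter_partial is \<psi> x\<bar> \<le> 3 / real (Suc n)))" for N n k D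
  define D where "D N n k = (SOME D. Q N n k D)" for N n k
  have "\<exists>D. Q N n k D" for N n k
    unfolding Q_def A_def by (rule test_functions_countable_approx)
  then have QD: "Q N n k (D N n k)" for N n k
    unfolding D_def by (rule someI_ex)
  have D: "\<And>N n k. countable (D N n k)" "\<And>N n k. D N n k \<subseteq> A N n k"
    "\<And>N n k \<phi>. \<phi> \<in> A N n k \<Longrightarrow> \<exists>\<psi>\<in>D N n k. \<forall>is. length is \<le> k \<longrightarrow>
     (\<forall>x. \<bar>iter_partial is \<phi> x - iter_partial is \<psi> x\<bar> \<le> 3 / real (Suc n))"
    using QD unfolding Q_def by blast+
  define E where "E = (\<Union>N n k. D N n k)"
  have Et: "E \<subseteq> test_functions"
    using D(2) unfolding E_def A_def by blast
  have ex_N: "\<exists>N. \<phi> \<in> A N n k" if \<phi>: "\<phi> \<in> test_functions" for \<phi> n k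
  proof -
    define Ls where "Ls = {is :: 'n list. length is \<le> k}"
    have "finite Ls"
      unfolding Ls_def using finite_lists_length_le[of "UNIV :: 'n set" k] by simp
    have "\<exists>d>0. \<forall>x\<in>cbox 0 1. \<forall>y\<in>cbox 0 1. dist x y < d \<longrightarrow>
        \<bar>iter_partial is \<phi> x - iter_partial is \<phi> y\<bar> < 1 / real (Suc n)" for "is"
      using compact_uniformly_continuous[OF continuous_on_iter_partial[OF test_functions_smooth[OF \<phi>]]
        compact_cbox[of 0 1], of "is"] unfolding uniformly_continuous_on_def dist_real_def
      by (metis dist_commute divide_pos_pos of_nat_0_less_iff zero_less_Suc zero_less_one)
    then obtain d where d: "\<And>is. d is > 0" "\<And>is x y. \<lbrakk>x\<in>cbox 0 1; y\<in>cbox 0 1; dist x y < d is\<rbrakk> \<Longrightarrow>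
        \<bar>iter_partial is \<phi> x - iter_partial is \<phi> y\<bar> < 1 / real (Suc n)" by metis
    have "Min (d ` Ls) > 0"
      using \<open>finite Ls\<close> d(1) by (subst Min_gr_iff) (auto simp: Ls_def intro: exI[of _ "[]"])
    then obtain N where N: "1 / real (Suc N) < Min (d ` Ls)"
      using nat_approx_posE by blast
    have "1 / real (Suc N) \<le> d is" if "length is \<le> k" for "is"
    proof -
      have "Min (d ` Ls) \<le> d is"
        using \<open>finite Ls\<close> that by (intro Min_le) (auto simp: Ls_def)
      then show ?thesis using N by linarith
    qed
    then have "\<phi> \<in> A N n k"
      unfolding A_def using \<phi> d(2) by (auto simp: order_less_le_trans)
    then show ?thesis ..
  qed
  have conv: "\<exists>\<psi>. (\<forall>n::nat. \<psi> n \<in> E) \<and> (\<forall>is. (\<lambda>n. sup_deriv is (\<lambda>x. \<phi> x - \<psi> n x)) \<longlonglongrightarrow> 0)"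
    if \<phi>: "\<phi> \<in> test_functions" for \<phi>
  proof -
    \<comment> \<open>A diagonal choice: \<open>n\<close> bounds both the order of the derivatives
      and the error, so for fixed \<open>is\<close> the estimate holds from
      \<open>n = length is\<close> on.\<close>
    have "\<exists>\<psi>\<in>E. \<forall>is. length is \<le> n \<longrightarrow>
     (\<forall>x. \<bar>iter_partial is \<phi> x - iter_partial is \<psi> x\<bar> \<le> 3 / real (Suc n))" for n
    proof -
      obtain N where "\<phi> \<in> A N n n" using ex_N[OF \<phi>] by blast
      from D(3)[OF this] show ?thesis unfolding E_def by blast
    qed
    then obtain \<psi> where \<psi>: "\<And>n. \<psi> n \<in> E" "\<And>n is x. length is \<le> n \<Longrightarrow>
        \<bar>iter_partial is \<phi> x - iter_partial is (\<psi> n) x\<bar> \<le> 3 / real (Suc n)" by metis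
    have sm: "smooth \<phi>" "smooth (\<psi> n)" for n
      using \<phi> \<psi>(1) Et by (auto intro: test_functions_smooth)
    have "(\<lambda>n. sup_deriv is (\<lambda>x. \<phi> x - \<psi> n x)) \<longlonglongrightarrow> 0" for "is"
    proof (rule tendsto_sandwich[of "\<lambda>_. 0" _ _ "\<lambda>n. 3 / real (Suc n)"])
      show "\<forall>\<^sub>F n in sequentially. sup_deriv is (\<lambda>x. \<phi> x - \<psi> n x) \<le> 3 / real (Suc n)"
        using eventually_ge_at_top[of "length is"]
      proof eventually_elim
        case (elim n)
        then show ?case unfolding sup_deriv_def iter_partial_diff[OF sm]
          by (intro cSUP_least \<psi>) auto
      qed
      show "\<forall>\<^sub>F n in sequentially. 0 \<le> sup_deriv is (\<lambda>x. \<phi> x - \<psi> n x)"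
        using Et \<psi>(1) \<phi> by (intro always_eventually allI sup_deriv_nonneg test_functions_diff) auto
      show "(\<lambda>n. 3 / real (Suc n)) \<longlonglongrightarrow> 0"
        using tendsto_mult_right_zero[OF lim_inverse_n', of 3] LIMSEQ_Suc[of "\<lambda>n. 3 / real n" 0] by simp
    qed simp
    then show ?thesis using \<psi>(1) by blast
  qed
  show thesis
  proof (rule that)
    show "countable E" unfolding E_def using D(1) by auto
  qed (use Et conv in auto)
qed

section \<open>Sequential continuity of generalized functions\<close>

lemma topspace_test_topology: "topspace test_topology = test_functions"
proof
  show "topspace test_topology \<subseteq> test_functions"
    unfolding test_topology_def topology_generated_by_topspace by (rule Union_least) auto
  show "test_functions \<subseteq> topspace (test_topology :: (real ^ 'n \<Rightarrow> real) topology)"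
  proof
    fix \<psi> :: "real ^ 'n \<Rightarrow> real" assume "\<psi> \<in> test_functions"
    then have "\<psi> \<in> {\<phi> \<in> test_functions. (SUP x. \<bar>iter_partial [] (\<lambda>y. \<phi> y - \<psi> y) x\<bar>) < 1}"
      by simp
    moreover have "{\<phi> \<in> test_functions. (SUP x. \<bar>iter_partial [] (\<lambda>y. \<phi> y - \<psi> y) x\<bar>) < 1}
        \<subseteq> topspace test_topology"
      unfolding test_topology_def topology_generated_by_topspace
      using \<open>\<psi> \<in> test_functions\<close> zero_less_one[where 'a=real]
      by (intro Union_upper CollectI exI conjI) (rule refl)
    ultimately show "\<psi> \<in> topspace test_topology" by blast
  qed
qed

text \<open>Convergence in all seminorms is convergence in \<open>test_topology\<close>: it is
  enough to be eventually in every subbasic ball around the limit. The centre \<eta> of such a ball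
  need not be \<phi>, so the convergence has to beat the room that \<phi> leaves, \<epsilon> minus
  the seminorm of \<open>\<phi> - \<eta>\<close>.\<close>

lemma gen_functions_sequentially_continuous:
  assumes f: "f \<in> gen_functions" and \<phi>: "\<phi> \<in> test_functions" and \<psi>: "\<And>n::nat. \<psi> n \<in> test_functions"
    and lim: "\<And>is. (\<lambda>n. sup_deriv is (\<lambda>x. \<phi> x - \<psi> n x)) \<longlonglongrightarrow> 0"
  shows "(\<lambda>n. f (\<psi> n)) \<longlonglongrightarrow> f \<phi>"
proof (rule topological_tendstoI)
  fix S :: "real set" assume S: "open S" "f \<phi> \<in> S"
  \<comment> \<open>Eventual membership survives finite intersections and arbitrary unions, hence
    passes from the subbase to all open sets.\<close>
  have ev: "generate_topology_on \<S> U \<Longrightarrow>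
     (\<And>V. V \<in> \<S> \<Longrightarrow> \<phi> \<in> V \<Longrightarrow> eventually (\<lambda>n. \<psi> n \<in> V) sequentially) \<Longrightarrow> \<phi> \<in> U \<Longrightarrow>
     eventually (\<lambda>n. \<psi> n \<in> U) sequentially" for U \<S>
  proof (induction rule: generate_topology_on.induct)
    case (Int a b)
    then show ?case by (auto intro: eventually_conj)
  next
    case (UN K)
    then obtain k where "k \<in> K" "\<phi> \<in> k" by blast
    with UN have "eventually (\<lambda>n. \<psi> n \<in> k) sequentially" by blast
    then show ?case by eventually_elim (use \<open>k \<in> K\<close> in blast)
  qed auto
  have "openin test_topology {\<eta> \<in> test_functions. f \<eta> \<in> S}"
    using f S(1) unfolding gen_functions_def continuous_map_def topspace_test_topology by auto
  then have gen: "generate_topology_on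
     {{\<psi> \<in> test_functions. (SUP x. \<bar>iter_partial is (\<lambda>y. \<psi> y - \<phi> y) x\<bar>) < \<epsilon>} | is \<phi> \<epsilon>.
        \<phi> \<in> test_functions \<and> 0 < \<epsilon>} {\<eta> \<in> test_functions. f \<eta> \<in> S}"
    unfolding test_topology_def by (rule openin_topology_generated_by)
  have "eventually (\<lambda>n. \<psi> n \<in> {\<eta> \<in> test_functions. f \<eta> \<in> S}) sequentially"
  proof (rule ev[OF gen])
    fix V assume "V \<in> {{\<psi> \<in> test_functions. (SUP x. \<bar>iter_partial is (\<lambda>y. \<psi> y - \<phi> y) x\<bar>) < \<epsilon>} | is \<phi> \<epsilon>.
        \<phi> \<in> test_functions \<and> 0 < \<epsilon>}" "\<phi> \<in> V"
    then obtain "is" \<eta> \<epsilon> where V: "V = {\<psi> \<in> test_functions. sup_deriv is (\<lambda>y. \<psi> y - \<eta> y) < \<epsilon>}"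
      and \<eta>: "\<eta> \<in> test_functions" and lt: "sup_deriv is (\<lambda>y. \<phi> y - \<eta> y) < \<epsilon>"
      unfolding sup_deriv_def by blast
    note sm = test_functions_smooth[OF \<phi>] test_functions_smooth[OF \<psi>] test_functions_smooth[OF \<eta>]
    from order_tendstoD(2)[OF lim[of "is"], of "\<epsilon> - sup_deriv is (\<lambda>y. \<phi> y - \<eta> y)"] lt
    have "eventually (\<lambda>n. sup_deriv is (\<lambda>x. \<phi> x - \<psi> n x) < \<epsilon> - sup_deriv is (\<lambda>y. \<phi> y - \<eta> y)) sequentially"
      by simp
    then show "eventually (\<lambda>n. \<psi> n \<in> V) sequentially"
    proof eventually_elim
      case (elim n)
      have "sup_deriv is (\<lambda>y. \<psi> n y - \<eta> y) \<le>
          sup_deriv is (\<lambda>x. \<phi> x - \<psi> n x) + sup_deriv is (\<lambda>y. \<phi> y - \<eta> y)"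
      proof (subst sup_deriv_def, rule cSUP_least)
        fix x
        have "\<bar>iter_partial is (\<lambda>x. \<phi> x - \<psi> n x) x\<bar> \<le> sup_deriv is (\<lambda>x. \<phi> x - \<psi> n x)"
          "\<bar>iter_partial is (\<lambda>x. \<phi> x - \<eta> x) x\<bar> \<le> sup_deriv is (\<lambda>x. \<phi> x - \<eta> x)"
          by (intro iter_partial_le_sup_deriv test_functions_diff \<phi> \<psi> \<eta>)+
        then show "\<bar>iter_partial is (\<lambda>y. \<psi> n y - \<eta> y) x\<bar> \<le>
          sup_deriv is (\<lambda>x. \<phi> x - \<psi> n x) + sup_deriv is (\<lambda>y. \<phi> y - \<eta> y)"
          unfolding iter_partial_diff[OF sm(1,2)] iter_partial_diff[OF sm(1,3)] iter_partial_diff[OF sm(2,3)]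
          by linarith
      qed auto
      then show ?case unfolding V using elim \<psi> by auto
    qed
  qed (use S \<phi> in auto)
  then show "eventually (\<lambda>n. f (\<psi> n) \<in> S) sequentially"
    by eventually_elim auto
qed

section \<open>Integration over \<open>real ^ 'n\<close>\<close>

lemma lborel_integral_translate:
  fixes f :: "'a::euclidean_space \<Rightarrow> real"
  assumes [measurable]: "f \<in> borel_measurable borel"
  shows "(LINT x|lborel. f (c + x)) = (LINT x|lborel. f x)"
proof -
  have "(LINT x|lborel. f x) = (LINT x|distr lborel borel ((+) c). f x)"
    by (simp add: lborel_distr_plus)
  also have "\<dots> = (LINT x|lborel. f (c + x))"
    by (rule integral_distr) auto
  finally show ?thesis ..
qed

lemma continuous_bounded_support_bounded:
  fixes f :: "'a::euclidean_space \<Rightarrow> real"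
  assumes "continuous_on UNIV f" and "\<And>x. f x \<noteq> 0 \<Longrightarrow> x \<in> cball 0 R"
  obtains B where "B \<ge> 0" "\<And>x. \<bar>f x\<bar> \<le> B"
proof -
  have "compact (f ` cball 0 R)"
    by (intro compact_continuous_image compact_cball continuous_on_subset[OF assms(1)] subset_UNIV)
  then obtain B where B: "\<forall>y\<in>f ` cball 0 R. \<bar>y\<bar> \<le> B"
    using compact_imp_bounded[of "f ` cball 0 R"] unfolding bounded_iff real_norm_def by blast
  have "\<bar>f x\<bar> \<le> max B 0" for x
    using B assms(2)[of x] by (cases "f x = 0") (auto simp: le_max_iff_disj)
  then show thesis using that[of "max B 0"] by auto
qed

lemma integrable_continuous_bounded_support:
  fixes f :: "'a::euclidean_space \<Rightarrow> real"
  assumes "continuous_on UNIV f" and "\<And>x. f x \<noteq> 0 \<Longrightarrow> x \<in> cball 0 R"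
  shows "integrable lborel f"
proof -
  obtain B where B: "\<And>x. \<bar>f x\<bar> \<le> B"
    using continuous_bounded_support_bounded[OF assms] by blast
  show ?thesis
  proof (rule integrableI_bounded_set[where A = "cball 0 R" and B = B])
    show "f \<in> borel_measurable lborel"
      using borel_measurable_continuous_onI[OF assms(1)] by simp
    show "emeasure lborel (cball 0 R) < \<infinity>" for R :: real
      by (rule emeasure_bounded_finite) simp
  qed (use B assms(2) in \<open>auto intro!: always_eventually\<close>)
qed

text \<open>
  Fubini's theorem for the coordinate \<open>a\<close>, through the product of \<open>real ^ 'n\<close> with a line:
  insert \<open>1 = \<integral> I (x $ a - t) dt\<close>, with \<open>I\<close> the indicator of \<open>{0..1}\<close>, and shear by \<open>t\<close> in direction \<open>a\<close>.
\<close>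

lemma integral_zero_if_slices_zero:
  fixes F :: "real ^ 'n::finite \<Rightarrow> real"
  assumes cont: "continuous_on UNIV F" and supp: "\<And>x. F x \<noteq> 0 \<Longrightarrow> x \<in> cball 0 R"
    and slices: "\<And>x. (LINT t|lborel. F (x + t *\<^sub>R axis a 1)) = 0"
  shows "(LINT x|lborel. F x) = 0"
proof -
  have [measurable]: "F \<in> borel_measurable borel"
    using borel_measurable_continuous_onI[OF cont] by simp
  obtain B where B: "B \<ge> 0" "\<And>x. \<bar>F x\<bar> \<le> B"
    using continuous_bounded_support_bounded[OF cont supp] by blast
  then have bnd: "norm (F x) \<le> max B 0" for x
    by (simp add: le_max_iff_disj)
  define I where "I = (\<lambda>s::real. indicat_real {0..1} s)"
  have [measurable]: "I \<in> borel_measurable borel" unfolding I_def by simp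
  have I01: "\<bar>I s\<bar> \<le> 1" for s by (auto simp: I_def indicator_def)
  have coord [measurable]: "(\<lambda>x :: real^'n. x $ a) \<in> borel_measurable borel"
    by (intro borel_measurable_continuous_onI continuous_intros)
  \<comment> \<open>One bounded set containing the supports of both integrands below. In the sheared
    one, \<open>0 \<le> x $ a \<le> 1\<close> and
    \<open>norm (x + t *\<^sub>R axis a 1) \<le> R\<close> force
    \<open>\<bar>t\<bar> \<le> R + 1\<close> and then \<open>norm x \<le> R + \<bar>t\<bar>\<close>;
    in the other one, \<open>norm x \<le> R\<close> and \<open>0 \<le> x $ a - t \<le> 1\<close>
    bound \<open>t\<close> alike.\<close>
  define A where "A = cball (0::real^'n) (2 * \<bar>R\<bar> + 2) \<times> cball (0::real) (\<bar>R\<bar> + 1)"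
  have A: "A \<in> sets (lborel \<Otimes>\<^sub>M lborel)" "emeasure (lborel \<Otimes>\<^sub>M lborel) A < \<infinity>"
    using emeasure_bounded_finite[of A]
    by (auto simp: A_def lborel_prod bounded_Times intro!: borel_closed closed_Times)
  have int1: "integrable (lborel \<Otimes>\<^sub>M lborel) (\<lambda>(x, t). I (x $ a) * F (x + t *\<^sub>R axis a 1))"
  proof (rule integrableI_bounded_set[where A = A and B = "max B 0"])
    show "(\<lambda>(x, t). I (x $ a) * F (x + t *\<^sub>R axis a 1)) \<in> borel_measurable (lborel \<Otimes>\<^sub>M lborel)"
      unfolding lborel_prod by (simp add: borel_prod[symmetric])
    show "AE x in lborel \<Otimes>\<^sub>M lborel. x \<in> A \<longrightarrow> norm (case x of (x, t) \<Rightarrow> I (x $ a) * F (x + t *\<^sub>R axis a 1)) \<le> max B 0"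
      using mult_mono[OF I01 bnd] by (auto intro!: always_eventually simp: abs_mult)
    show "AE x in lborel \<Otimes>\<^sub>M lborel. x \<notin> A \<longrightarrow> (case x of (x, t) \<Rightarrow> I (x $ a) * F (x + t *\<^sub>R axis a 1)) = 0"
    proof (intro always_eventually allI impI, clarify)
      fix x :: "real^'n" and t :: real assume nA: "(x, t) \<notin> A"
      show "I (x $ a) * F (x + t *\<^sub>R axis a 1) = 0"
      proof (rule ccontr)
        assume "I (x $ a) * F (x + t *\<^sub>R axis a 1) \<noteq> 0"
        then have x: "0 \<le> x $ a" "x $ a \<le> 1" and n: "norm (x + t *\<^sub>R axis a 1) \<le> R"
          using supp by (auto simp: I_def indicator_def split: if_splits)
        have "\<bar>(x + t *\<^sub>R axis a 1) $ a\<bar> \<le> R"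
          using component_le_norm_cart[of "x + t *\<^sub>R axis a 1" a] n by linarith
        then have t: "\<bar>t\<bar> \<le> \<bar>R\<bar> + 1" using x by (simp add: axis_def)
        have "norm x \<le> norm (x + t *\<^sub>R axis a 1) + norm (t *\<^sub>R (axis a 1 :: real^'n))"
          using norm_triangle_ineq4[of "x + t *\<^sub>R axis a 1" "t *\<^sub>R axis a 1"] by simp
        also have "\<dots> \<le> R + \<bar>t\<bar>" using n by (simp add: norm_axis_1)
        finally show False using t nA by (auto simp: A_def)
      qed
    qed
  qed (rule A)+
  have int2: "integrable (lborel \<Otimes>\<^sub>M lborel) (\<lambda>(x, t). I (x $ a - t) * F x)"
  proof (rule integrableI_bounded_set[where A = A and B = "max B 0"])
    show "(\<lambda>(x, t). I (x $ a - t) * F x) \<in> borel_measurable (lborel \<Otimes>\<^sub>M lborel)"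
      unfolding lborel_prod by (simp add: borel_prod[symmetric])
    show "AE x in lborel \<Otimes>\<^sub>M lborel. x \<in> A \<longrightarrow> norm (case x of (x, t) \<Rightarrow> I (x $ a - t) * F x) \<le> max B 0"
      using mult_mono[OF I01 bnd] by (auto intro!: always_eventually simp: abs_mult)
    show "AE x in lborel \<Otimes>\<^sub>M lborel. x \<notin> A \<longrightarrow> (case x of (x, t) \<Rightarrow> I (x $ a - t) * F x) = 0"
    proof (intro always_eventually allI impI, clarify)
      fix x :: "real^'n" and t :: real assume nA: "(x, t) \<notin> A"
      show "I (x $ a - t) * F x = 0"
      proof (rule ccontr)
        assume "I (x $ a - t) * F x \<noteq> 0"
        then have x: "0 \<le> x $ a - t" "x $ a - t \<le> 1" and n: "norm x \<le> R"
          using supp by (auto simp: I_def indicator_def split: if_splits)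
        then show False using component_le_norm_cart[of x a] nA by (auto simp: A_def)
      qed
    qed
  qed (rule A)+
  have "(LINT x|lborel. F x) = (LINT x|lborel. LINT t|lborel. I (x $ a - t) * F x)"
  proof (rule Bochner_Integration.integral_cong[OF refl])
    fix x :: "real^'n"
    have "(LINT t|lborel. I (x $ a - t)) = (LINT t|lborel. indicat_real {x $ a - 1..x $ a} t)"
      by (rule Bochner_Integration.integral_cong) (auto simp: I_def indicator_def)
    also have "\<dots> = 1" by simp
    finally show "F x = (LINT t|lborel. I (x $ a - t) * F x)" by simp
  qed
  also have "\<dots> = (LINT t|lborel. LINT x|lborel. I (x $ a - t) * F x)"
    using lborel_pair.Fubini_integral[of "\<lambda>x t. I (x $ a - t) * F x"] int2 by simp
  also have "\<dots> = (LINT t|lborel. LINT x|lborel. I (x $ a) * F (x + t *\<^sub>R axis a 1))"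
  proof (rule Bochner_Integration.integral_cong[OF refl])
    fix t :: real
    show "(LINT x|lborel. I (x $ a - t) * F x) = (LINT x|lborel. I (x $ a) * F (x + t *\<^sub>R axis a 1))"
      by (subst lborel_integral_translate[symmetric, of _ "t *\<^sub>R axis a 1"])
         (auto simp: axis_def add.commute)
  qed
  also have "\<dots> = (LINT x|lborel. LINT t|lborel. I (x $ a) * F (x + t *\<^sub>R axis a 1))"
    using lborel_pair.Fubini_integral[of "\<lambda>x t. I (x $ a) * F (x + t *\<^sub>R axis a 1)"] int1 by simp
  also have "\<dots> = 0" using slices by simp
  finally show ?thesis .
qed

section \<open>Counting integer vectors and unfolding periodizations\<close>

lemma bij_betw_vec_nth:
  "bij_betw vec_nth {k :: 'a ^ 'n::finite. \<forall>a. k $ a \<in> S} (UNIV \<rightarrow>\<^sub>E S)"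
  by (rule bij_betw_byWitness[where f' = vec_lambda]) (auto simp: vec_lambda_beta)

lemma finite_vec_set: "finite S \<Longrightarrow> finite {k :: 'a ^ 'n::finite. \<forall>a. k $ a \<in> S}"
  using bij_betw_finite[OF bij_betw_vec_nth[where 'n='n], of S] finite_PiE[of "UNIV :: 'n set" "\<lambda>_. S"] by simp

lemma card_vec_set: "card {k :: 'a ^ 'n::finite. \<forall>a. k $ a \<in> S} = card S ^ CARD('n)"
  using bij_betw_same_card[OF bij_betw_vec_nth[where 'n='n], of S] card_PiE[of "UNIV :: 'n set" "\<lambda>_. S"] by simp

text \<open>The integer translates of a fundamental cube tile the space, and periodicity of \<phi>
  lets each translate be moved back to the cube. All later estimates can thus use the compactly
  supported wavelet on the whole space in place of its periodization.\<close>

lemma integral_periodization: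
  fixes w \<phi> :: "real ^ 'n::finite \<Rightarrow> real"
  assumes cont: "continuous_on UNIV w" and supp: "\<And>x. w x \<noteq> 0 \<Longrightarrow> x \<in> cball 0 R"
    and cont_\<phi>: "continuous_on UNIV \<phi>" and per: "\<And>x k. \<phi> (x + int_vec k) = \<phi> x"
  shows "(LINT x:cbox 0 1|lborel. (\<Sum>\<^sub>\<infinity>k. w (x + int_vec k)) * \<phi> x) = (LINT x|lborel. w x * \<phi> x)"
proof -
  \<comment> \<open>The translations that can carry a point of the unit cube into the support of
    \<open>w\<close>: their entries have modulus at most \<open>R + 1\<close>. The periodization is
    then a finite sum on the cube.\<close>
  define K where "K = {k :: int ^ 'n. \<forall>a. k $ a \<in> {- \<lceil>R\<rceil> - 1..\<lceil>R\<rceil> + 1}}"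
  have "finite K" unfolding K_def by (rule finite_vec_set) simp
  \<comment> \<open>The half-open cube: its integer translates are disjoint, whereas those of
    \<open>cbox 0 1\<close> overlap. The two cubes differ only by a null set.\<close>
  define H where "H = {x :: real ^ 'n. \<forall>a. 0 \<le> x $ a \<and> x $ a < 1}"
  have [measurable]: "w \<in> borel_measurable borel" "\<phi> \<in> borel_measurable borel"
    using borel_measurable_continuous_onI cont cont_\<phi> by auto
  have coord [measurable]: "(\<lambda>x :: real^'n. x $ a) \<in> borel_measurable borel" for a
    by (intro borel_measurable_continuous_onI continuous_intros)
  have [measurable]: "H \<in> sets borel"
  proof -
    have "{x \<in> space borel. \<forall>a. 0 \<le> x $ a \<and> x $ a < 1} \<in> sets (borel :: (real ^ 'n) measure)"
      by measurable
    then show ?thesis by (simp add: H_def)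
  qed
  have out: "w (x + int_vec k) = 0" if "x \<in> cbox 0 1" "k \<notin> K" for x k
  proof (rule ccontr)
    assume "w (x + int_vec k) \<noteq> 0"
    then have n: "norm (x + int_vec k) \<le> R" using supp by auto
    have "k $ a \<in> {- \<lceil>R\<rceil> - 1..\<lceil>R\<rceil> + 1}" for a
    proof -
      have "\<bar>(x + int_vec k) $ a\<bar> \<le> R"
        using component_le_norm_cart[of "x + int_vec k" a] n by linarith
      moreover have "0 \<le> x $ a \<and> x $ a \<le> 1"
        using that by (auto simp: mem_box_cart)
      ultimately have "\<bar>real_of_int (k $ a)\<bar> \<le> R + 1" by (auto simp: int_vec_def)
      then show ?thesis by simp linarith
    qed
    then show False using that by (auto simp: K_def)
  qed
  have sum: "(\<Sum>\<^sub>\<infinity>k. w (x + int_vec k)) = (\<Sum>k\<in>K. w (x + int_vec k))" if "x \<in> cbox 0 1" for x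
  proof -
    have "(\<Sum>\<^sub>\<infinity>k. w (x + int_vec k)) = (\<Sum>\<^sub>\<infinity>k\<in>K. w (x + int_vec k))"
      by (rule infsum_cong_neutral) (use out that in auto)
    then show ?thesis using \<open>finite K\<close> by simp
  qed
  have int: "integrable lborel (\<lambda>x. w x * \<phi> x)"
    by (rule integrable_continuous_bounded_support[where R = R])
       (use cont cont_\<phi> supp in \<open>auto intro!: continuous_intros\<close>)
  have intH: "integrable lborel (\<lambda>x. indicat_real H (x - int_vec k) * (w x * \<phi> x))" for k
  proof (rule Bochner_Integration.integrable_bound[OF int])
    show "AE x in lborel. norm (indicat_real H (x - int_vec k) * (w x * \<phi> x)) \<le> norm (w x * \<phi> x)"
      by (auto intro!: always_eventually simp: indicator_def)
  qed simp
  have shift: "(LINT x|lborel. indicat_real H (x - int_vec k) * (w x * \<phi> x)) =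
      (LINT x|lborel. indicat_real H x * (w (x + int_vec k) * \<phi> x))" for k
    by (subst lborel_integral_translate[symmetric, of _ "int_vec k"]) (simp_all add: add.commute per)
  have intH': "integrable lborel (\<lambda>x. indicat_real H x * (w (x + int_vec k) * \<phi> x))" for k
  proof -
    have "integrable (distr lborel borel ((+) (int_vec k))) (\<lambda>x. indicat_real H (x - int_vec k) * (w x * \<phi> x))"
      unfolding lborel_distr_plus by (rule intH)
    then have "integrable lborel (\<lambda>x. indicat_real H (int_vec k + x - int_vec k) * (w (int_vec k + x) * \<phi> (int_vec k + x)))"
      by (rule integrable_distr[rotated]) simp
    then show ?thesis by (simp add: add.commute per)
  qed
  have "(LINT x:cbox 0 1|lborel. (\<Sum>\<^sub>\<infinity>k. w (x + int_vec k)) * \<phi> x) =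
      (LINT x|lborel. indicat_real (cbox 0 1) x * (\<Sum>k\<in>K. w (x + int_vec k) * \<phi> x))"
    unfolding set_lebesgue_integral_def
    by (rule Bochner_Integration.integral_cong) (auto simp: sum sum_distrib_right indicator_def)
  also have "\<dots> = (LINT x|lborel. indicat_real H x * (\<Sum>k\<in>K. w (x + int_vec k) * \<phi> x))"
  proof (rule integral_cong_AE)
    have "negligible (cbox 0 1 - box 0 (1 :: real ^ 'n))"
      by (rule negligible_frontier_interval)
    then have "cbox 0 1 - box 0 (1 :: real ^ 'n) \<in> null_sets lborel"
      by (simp add: negligible_iff_null_sets null_sets_completion_iff)
    then have "AE x :: real ^ 'n in lborel. x \<notin> cbox 0 1 - box 0 1"
      by (rule AE_not_in)
    then show "AE x in lborel. indicat_real (cbox 0 1) x * (\<Sum>k\<in>K. w (x + int_vec k) * \<phi> x) =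
        indicat_real H x * (\<Sum>k\<in>K. w (x + int_vec k) * \<phi> x)"
    proof eventually_elim
      case (elim x)
      have "x \<in> cbox 0 1 \<longleftrightarrow> x \<in> H"
        using elim by (auto simp: H_def mem_box_cart intro: less_imp_le)
      then show ?case by (simp add: indicator_def)
    qed
  qed simp_all
  also have "\<dots> = (\<Sum>k\<in>K. (LINT x|lborel. indicat_real H x * (w (x + int_vec k) * \<phi> x)))"
    unfolding sum_distrib_left by (rule Bochner_Integration.integral_sum) (rule intH')
  also have "\<dots> = (\<Sum>k\<in>K. (LINT x|lborel. indicat_real H (x - int_vec k) * (w x * \<phi> x)))"
    unfolding shift ..
  also have "\<dots> = (LINT x|lborel. (\<Sum>k\<in>K. indicat_real H (x - int_vec k) * (w x * \<phi> x)))"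
    by (rule Bochner_Integration.integral_sum[symmetric]) (rule intH)
  also have "\<dots> = (LINT x|lborel. w x * \<phi> x)"
  proof (rule Bochner_Integration.integral_cong[OF refl])
    fix x :: "real ^ 'n"
    show "(\<Sum>k\<in>K. indicat_real H (x - int_vec k) * (w x * \<phi> x)) = w x * \<phi> x"
    proof (cases "w x = 0")
      case False
      then have n: "norm x \<le> R" using supp by auto
      \<comment> \<open>The only integer vector whose translate of \<open>H\<close> contains
        \<open>x\<close>, so a single summand survives.\<close>
      define k0 :: "int ^ 'n" where "k0 = (\<chi> a. \<lfloor>x $ a\<rfloor>)"
      have ind: "indicat_real H (x - int_vec k) = (if k = k0 then 1 else 0)" for k
      proof -
        have "x - int_vec k \<in> H \<longleftrightarrow> (\<forall>a. k $ a = \<lfloor>x $ a\<rfloor>)"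
          unfolding H_def int_vec_def by (auto simp: floor_eq_iff eq_commute[of "k $ _"] algebra_simps)
        then show ?thesis by (auto simp: k0_def vec_eq_iff indicator_def)
      qed
      have "k0 $ a \<in> {- \<lceil>R\<rceil> - 1..\<lceil>R\<rceil> + 1}" for a
      proof -
        have "\<bar>x $ a\<bar> \<le> R" using component_le_norm_cart[of x a] n by linarith
        then show ?thesis unfolding k0_def by simp linarith
      qed
      then have "k0 \<in> K" by (auto simp: K_def)
      then show ?thesis unfolding ind using \<open>finite K\<close>
        by (simp add: if_distrib[of "\<lambda>c. c * _"] cong: if_cong)
    qed simp
  qed
  finally show ?thesis .
qed

section \<open>Decay of wavelet coefficients\<close>

lemma iter_partial_DERIV:
  assumes "smooth f"
  shows "((\<lambda>t. iter_partial is f (x + t *\<^sub>R axis a 1)) has_field_derivative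
      iter_partial (a # is) f (x + t *\<^sub>R axis a 1)) (at t)"
proof -
  have "(iter_partial is f \<circ> (\<lambda>t. x + t *\<^sub>R axis a 1) has_derivative
      frechet_derivative (iter_partial is f) (at (x + t *\<^sub>R axis a 1)) \<circ> (\<lambda>t. t *\<^sub>R axis a 1)) (at t)"
  proof (rule diff_chain_at)
    show "((\<lambda>t. x + t *\<^sub>R axis a 1) has_derivative (\<lambda>t. t *\<^sub>R axis a 1)) (at t)"
      by (auto intro!: derivative_eq_intros)
  qed (rule iter_partial_has_derivative[OF assms])
  moreover have "linear (frechet_derivative (iter_partial is f) (at (x + t *\<^sub>R axis a 1)))"
    by (rule has_derivative_linear[OF iter_partial_has_derivative[OF assms]])
  ultimately show ?thesis
    by (simp add: o_def has_field_derivative_def linear_cmul mult.commute[of _ "frechet_derivative _ _ _"] mult_commute_abs)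
qed

lemma Taylor_in_direction:
  assumes \<phi>: "\<phi> \<in> test_functions"
  shows "\<bar>\<phi> (x + h *\<^sub>R axis a 1) - (\<Sum>k<u. iter_partial (replicate k a) \<phi> x / fact k * h ^ k)\<bar>
    \<le> sup_deriv (replicate u a) \<phi> * \<bar>h\<bar> ^ u"
proof -
  let ?d = "\<lambda>k t. iter_partial (replicate k a) \<phi> (x + t *\<^sub>R axis a 1)"
  have "\<exists>t. \<bar>t\<bar> \<le> \<bar>h\<bar> \<and> \<phi> (x + h *\<^sub>R axis a 1) = (\<Sum>m<u. (?d m 0 / fact m) * h ^ m) + (?d u t / fact u) * h ^ u"
    using iter_partial_DERIV[OF test_functions_smooth[OF \<phi>]]
    by (intro Maclaurin_all_le) (auto simp del: iter_partial.simps simp: iter_partial.simps(1))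
  then obtain t where t: "\<phi> (x + h *\<^sub>R axis a 1) = (\<Sum>m<u. (?d m 0 / fact m) * h ^ m) + (?d u t / fact u) * h ^ u"
    by blast
  have "\<bar>?d u t / fact u * h ^ u\<bar> \<le> sup_deriv (replicate u a) \<phi> * \<bar>h\<bar> ^ u"
  proof -
    have "\<bar>?d u t\<bar> / fact u \<le> \<bar>?d u t\<bar> / 1"
      by (intro divide_left_mono) auto
    also have "\<dots> \<le> sup_deriv (replicate u a) \<phi>"
      using iter_partial_le_sup_deriv[OF \<phi>] by simp
    finally have "\<bar>?d u t\<bar> / fact u * \<bar>h\<bar> ^ u \<le> sup_deriv (replicate u a) \<phi> * \<bar>h\<bar> ^ u"
      by (rule mult_right_mono) simp
    then show ?thesis by (simp add: abs_mult power_abs)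
  qed
  then show ?thesis unfolding t by simp
qed

section \<open>Support, size and moments of a single wavelet\<close>

lemma wavelet_system_continuous:
  assumes "wavelet_system u \<psi>"
  shows "continuous_on UNIV (\<psi> K)"
proof (cases u)
  case 0
  have "continuous_on UNIV ((deriv ^^ u) (\<psi> K))"
    using assms unfolding wavelet_system_def by blast
  then show ?thesis using 0 by simp
next
  case (Suc v)
  then have "\<forall>x. (deriv ^^ 0) (\<psi> K) field_differentiable (at x)"
    using assms unfolding wavelet_system_def by blast
  then show ?thesis
    by (auto intro!: continuous_at_imp_continuous_on field_differentiable_imp_continuous_at)
qed

text \<open>The normalisation \<open>\<rho> \<ge> 1\<close> serves the wavelets of scale 0 without a
  factor \<open>\<psi> M\<close>: there the Taylor factor \<open>(\<rho> / 2 ^ j) ^ u\<close> is at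
  least 1 and can be inserted for free, so that all types share one bound.\<close>

lemma wavelet_system_support:
  assumes "wavelet_system u \<psi>"
  obtains \<rho> where "\<rho> \<ge> 1" "\<forall>K x. \<psi> K x \<noteq> 0 \<longrightarrow> \<bar>x\<bar> \<le> \<rho>"
proof -
  have "\<exists>r. \<forall>x. \<psi> K x \<noteq> 0 \<longrightarrow> \<bar>x\<bar> \<le> r" for K
  proof -
    have "compact (closure {x. \<psi> K x \<noteq> 0})"
      using assms unfolding wavelet_system_def by blast
    then have "bounded {x. \<psi> K x \<noteq> 0}"
      using compact_imp_bounded bounded_closure bounded_subset closure_subset by metis
    then show ?thesis by (auto simp: bounded_iff)
  qed
  then obtain r where r: "\<And>K x. \<psi> K x \<noteq> 0 \<Longrightarrow> \<bar>x\<bar> \<le> r K" by metis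
  show thesis
  proof (rule that)
    show "max 1 (max (r F) (r M)) \<ge> 1" by simp
    have "\<bar>x\<bar> \<le> max 1 (max (r F) (r M))" if "\<psi> K x \<noteq> 0" for K x
      using r[OF that] by (cases K) auto
    then show "\<forall>K x. \<psi> K x \<noteq> 0 \<longrightarrow> \<bar>x\<bar> \<le> max 1 (max (r F) (r M))"
      by blast
  qed
qed

lemma wavelet_system_bounded:
  assumes "wavelet_system u \<psi>"
  obtains B where "B \<ge> 0" "\<And>K x. \<bar>\<psi> K x\<bar> \<le> B"
proof -
  obtain \<rho> where "\<rho> \<ge> 1" and \<rho>: "\<forall>K x. \<psi> K x \<noteq> 0 \<longrightarrow> \<bar>x\<bar> \<le> \<rho>"
    by (rule wavelet_system_support[OF assms]) blast
  have supp: "x \<in> cball 0 \<rho>" if "\<psi> K x \<noteq> 0" for K x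
    using \<rho> that by simp
  have "\<exists>B. \<forall>x. \<bar>\<psi> K x\<bar> \<le> B" for K
    by (rule continuous_bounded_support_bounded[OF wavelet_system_continuous[OF assms] supp]) blast+
  then obtain b where b: "\<And>K x. \<bar>\<psi> K x\<bar> \<le> b K" by metis
  show thesis
  proof (rule that)
    show "max 0 (max (b F) (b M)) \<ge> 0" by simp
    show "\<bar>\<psi> K x\<bar> \<le> max 0 (max (b F) (b M))" for K x
      using b[of K x] by (cases K) auto
  qed
qed

lemma wavelet_system_moments:
  "wavelet_system u \<psi> \<Longrightarrow> k < u \<Longrightarrow> (LINT x|lborel. x ^ k * \<psi> M x) = 0"
  unfolding wavelet_system_def by blast

lemma continuous_on_wavelet:
  assumes "wavelet_system u \<psi>"
  shows "continuous_on UNIV (wavelet \<psi> L j G m)"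
proof -
  have "continuous_on UNIV (\<lambda>x. \<psi> (G a) (2 ^ (j + L) * x $ a - real_of_int (m $ a)))" for a
    by (rule continuous_on_compose2[OF wavelet_system_continuous[OF assms]])
       (auto intro!: continuous_intros)
  then show ?thesis
    unfolding wavelet_def by (intro continuous_intros) auto
qed

lemma wavelet_support:
  assumes \<rho>: "\<forall>K x. \<psi> K x \<noteq> 0 \<longrightarrow> \<bar>x\<bar> \<le> \<rho>" and nz: "wavelet \<psi> L j G m x \<noteq> 0"
  shows "\<bar>x $ a - of_int (m $ a) / 2 ^ (j + L)\<bar> \<le> \<rho> / 2 ^ (j + L)"
proof -
  have "\<psi> (G a) (2 ^ (j + L) * x $ a - of_int (m $ a)) \<noteq> 0"
    using nz unfolding wavelet_def by auto
  then have "\<bar>2 ^ (j + L) * x $ a - of_int (m $ a)\<bar> \<le> \<rho>" using \<rho> by blast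
  moreover have "\<bar>2 ^ (j + L) * x $ a - of_int (m $ a)\<bar> =
      2 ^ (j + L) * \<bar>x $ a - of_int (m $ a) / 2 ^ (j + L)\<bar>"
    unfolding abs_mult_pos'[symmetric, of "2 ^ (j + L)", simplified] by (simp add: field_simps)
  ultimately show ?thesis by (simp add: field_simps)
qed

definition wavelet_center :: "nat \<Rightarrow> nat \<Rightarrow> int ^ 'n \<Rightarrow> real ^ 'n::finite" where
  "wavelet_center L j m = (\<chi> a. of_int (m $ a) / 2 ^ (j + L))"

lemma wavelet_support_cbox:
  assumes \<rho>: "\<forall>K x. \<psi> K x \<noteq> 0 \<longrightarrow> \<bar>x\<bar> \<le> \<rho>" and nz: "wavelet \<psi> L j G m x \<noteq> 0"
  shows "x \<in> cbox (wavelet_center L j m - (\<chi> a. \<rho> / 2 ^ (j + L))) (wavelet_center L j m + (\<chi> a. \<rho> / 2 ^ (j + L)))"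
  using wavelet_support[where \<psi> = \<psi>, OF assms] by (auto simp: mem_box_cart wavelet_center_def abs_le_iff algebra_simps)

lemma wavelet_support_cball:
  assumes "wavelet_system u \<psi>"
  obtains R where "\<And>x. wavelet \<psi> L j G m x \<noteq> 0 \<Longrightarrow> x \<in> cball 0 R"
proof -
  obtain \<rho> where "\<rho> \<ge> 1" and \<rho>: "\<forall>K x. \<psi> K x \<noteq> 0 \<longrightarrow> \<bar>x\<bar> \<le> \<rho>"
    by (rule wavelet_system_support[OF assms]) blast
  obtain R where R: "\<forall>x\<in>cbox (wavelet_center L j m - (\<chi> a. \<rho> / 2 ^ (j + L))) (wavelet_center L j m + (\<chi> a. \<rho> / 2 ^ (j + L))). norm x \<le> R"
    using bounded_cbox unfolding bounded_iff by blast
  have "norm x \<le> R" if "wavelet \<psi> L j G m x \<noteq> 0" for x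
    by (rule R[rule_format, OF wavelet_support_cbox[OF \<rho> that]])
  then show thesis using that[of R] by simp
qed

text \<open>Sup norm times the volume of a cube of side \<open>2 * \<rho> / 2 ^ (j + L)\<close>. The
  bound on \<open>g\<close> is asked only where the wavelet is nonzero, because a Taylor remainder
  is small only near the centre.\<close>

lemma wavelet_integral_bound:
  fixes g :: "real ^ 'n::finite \<Rightarrow> real"
  assumes sys: "wavelet_system u \<psi>" and \<rho>: "\<rho> \<ge> 0" "\<forall>K x. \<psi> K x \<noteq> 0 \<longrightarrow> \<bar>x\<bar> \<le> \<rho>"
    and B: "B \<ge> 0" "\<And>K x. \<bar>\<psi> K x\<bar> \<le> B"
    and g: "continuous_on UNIV g" and c: "c \<ge> 0" "\<And>x. wavelet \<psi> L j G m x \<noteq> 0 \<Longrightarrow> \<bar>g x\<bar> \<le> c"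
  shows "\<bar>LINT x|lborel. wavelet \<psi> L j G m x * g x\<bar> \<le>
    2 powr (real (j + L) * real CARD('n) / 2) * B ^ CARD('n) * c * (2 * \<rho> / 2 ^ (j + L)) ^ CARD('n)"
proof -
  define E where "E = 2 powr (real (j + L) * real CARD('n) / 2) * B ^ CARD('n) * c"
  have "E \<ge> 0" unfolding E_def using B c by simp
  define Q where "Q = cbox (wavelet_center L j m - (\<chi> a. \<rho> / 2 ^ (j + L))) (wavelet_center L j m + (\<chi> a. \<rho> / 2 ^ (j + L)) :: real ^ 'n)"
  obtain R where R: "\<And>x. wavelet \<psi> L j G m x \<noteq> 0 \<Longrightarrow> x \<in> cball 0 R"
    by (rule wavelet_support_cball[OF sys, of L j G m]) blast
  have int: "integrable lborel (\<lambda>x. wavelet \<psi> L j G m x * g x)"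
    by (rule integrable_continuous_bounded_support[where R = R])
       (use R in \<open>auto intro!: continuous_intros continuous_on_wavelet[OF sys] g\<close>)
  have pt: "\<bar>wavelet \<psi> L j G m x * g x\<bar> \<le> indicat_real Q x * E" for x
  proof (cases "wavelet \<psi> L j G m x = 0")
    case True
    then show ?thesis using \<open>E \<ge> 0\<close> by simp
  next
    case False
    have "\<bar>\<Prod>a\<in>UNIV. \<psi> (G a) (2 ^ (j + L) * x $ a - of_int (m $ a))\<bar> \<le> (\<Prod>a\<in>(UNIV :: 'n set). B)"
      unfolding abs_prod by (intro prod_mono) (auto simp: B)
    then have "\<bar>wavelet \<psi> L j G m x\<bar> \<le> 2 powr (real (j + L) * real CARD('n) / 2) * B ^ CARD('n)"
      unfolding wavelet_def by (simp add: abs_mult)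
    then have "\<bar>wavelet \<psi> L j G m x * g x\<bar> \<le> E"
      unfolding abs_mult E_def using c(2)[OF False] B by (intro mult_mono) auto
    then show ?thesis using wavelet_support_cbox[where \<psi> = \<psi>, OF \<rho>(2) False] by (simp add: Q_def)
  qed
  have meas: "measure lborel Q = (2 * \<rho> / 2 ^ (j + L)) ^ CARD('n)"
  proof -
    have "measure lborel Q = (\<Prod>a\<in>(UNIV :: 'n set). 2 * \<rho> / 2 ^ (j + L))"
      unfolding Q_def using \<rho>
      by (subst content_cbox_cart) (auto simp: interval_ne_empty_cart intro!: prod.cong)
    then show ?thesis by simp
  qed
  have fin: "emeasure lborel Q < \<infinity>" unfolding Q_def by (rule emeasure_bounded_finite) simp
  have "\<bar>LINT x|lborel. wavelet \<psi> L j G m x * g x\<bar> \<le> (LINT x|lborel. \<bar>wavelet \<psi> L j G m x * g x\<bar>)"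
    by (rule integral_abs_bound)
  also have "\<dots> \<le> (LINT x|lborel. indicat_real Q x * E)"
  proof (intro integral_mono pt integrable_abs int integrable_mult_left integrable_real_indicator fin)
    show "Q \<in> sets lborel" by (simp add: Q_def)
  qed
  also have "\<dots> = measure lborel Q * E"
    by (simp add: Q_def)
  finally show ?thesis unfolding meas E_def by (simp add: mult_ac)
qed

text \<open>The affine substitution \<open>y = 2 ^ J * (s + t) - m\<close> turns the
  \<open>k\<close>-th moment of \<open>\<psi> M\<close> about 0 into the moment of the dilated
  wavelet about its centre \<open>m / 2 ^ J\<close>.\<close>

lemma scaled_moment_zero:
  assumes sys: "wavelet_system u \<psi>" and k: "k < u"
  shows "(LINT t|lborel. \<psi> M (2 ^ J * (s + t) - of_int m) * (s + t - of_int m / 2 ^ J) ^ k) = 0"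
proof -
  define X where "X = (2::real) ^ J"
  have X: "X > 0" by (simp add: X_def)
  have "0 = (LINT y|lborel. y ^ k * \<psi> M y)"
    using wavelet_system_moments[OF assms] by simp
  also have "\<dots> = X * (LINT t|lborel. (X * s - m + X * t) ^ k * \<psi> M (X * s - m + X * t))"
    using X by (subst lborel_integral_real_affine[of X _ "X * s - m"]) auto
  also have "(LINT t|lborel. (X * s - m + X * t) ^ k * \<psi> M (X * s - m + X * t)) =
      (LINT t|lborel. X ^ k * (\<psi> M (X * (s + t) - m) * (s + t - m / X) ^ k))"
  proof (rule Bochner_Integration.integral_cong[OF refl])
    fix t
    have eq: "X * s - m + X * t = X * (s + t - m / X)" "X * (s + t) - m = X * (s + t - m / X)"
      using X by (auto simp: field_simps)
    show "(X * s - m + X * t) ^ k * \<psi> M (X * s - m + X * t) = X ^ k * (\<psi> M (X * (s + t) - m) * (s + t - m / X) ^ k)"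
      unfolding eq by (simp add: power_mult_distrib)
  qed
  also have "\<dots> = X ^ k * (LINT t|lborel. \<psi> M (X * (s + t) - m) * (s + t - m / X) ^ k)"
    by simp
  finally show ?thesis using X by (simp add: X_def)
qed

lemma wavelet_shift:
  fixes x :: "real ^ 'n::finite"
  assumes "G a = M"
  shows "wavelet \<psi> L j G m (x + t *\<^sub>R axis a 1) =
    2 powr (real (j + L) * real CARD('n) / 2) *
    (\<Prod>b\<in>UNIV - {a}. \<psi> (G b) (2 ^ (j + L) * x $ b - of_int (m $ b))) *
    \<psi> M (2 ^ (j + L) * (x $ a + t) - of_int (m $ a))"
proof -
  have "(\<Prod>b\<in>UNIV. \<psi> (G b) (2 ^ (j + L) * (x + t *\<^sub>R axis a 1) $ b - of_int (m $ b))) =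
     \<psi> M (2 ^ (j + L) * (x $ a + t) - of_int (m $ a)) *
     (\<Prod>b\<in>UNIV - {a}. \<psi> (G b) (2 ^ (j + L) * x $ b - of_int (m $ b)))"
    by (subst prod.remove[of UNIV a]) (auto simp: assms axis_def intro!: prod.cong)
  then show ?thesis unfolding wavelet_def by simp
qed

text \<open>On a line in direction \<open>a\<close> all factors are constant except
  \<open>\<psi> M\<close> and the monomial, so each slice integral is a multiple of a vanishing
  moment. The factor \<open>g\<close> is meant for Taylor coefficients, which may depend on the
  other coordinates.\<close>

lemma wavelet_moment_zero:
  fixes g :: "real ^ 'n::finite \<Rightarrow> real"
  assumes sys: "wavelet_system u \<psi>" and k: "k < u" and G: "G a = M"
    and g: "continuous_on UNIV g" "\<And>x t. g (x + t *\<^sub>R axis a 1) = g x"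
  shows "(LINT x|lborel. wavelet \<psi> L j G m x * (g x * (x $ a - wavelet_center L j m $ a) ^ k)) = 0"
proof -
  obtain R where R: "\<And>x. wavelet \<psi> L j G m x \<noteq> 0 \<Longrightarrow> x \<in> cball 0 R"
    by (rule wavelet_support_cball[OF sys, of L j G m]) blast
  show ?thesis
  proof (rule integral_zero_if_slices_zero[where R = R and a = a])
    show "continuous_on UNIV (\<lambda>x. wavelet \<psi> L j G m x * (g x * (x $ a - wavelet_center L j m $ a) ^ k))"
      by (intro continuous_intros continuous_on_wavelet[OF sys] g)
    show "x \<in> cball 0 R" if "wavelet \<psi> L j G m x * (g x * (x $ a - wavelet_center L j m $ a) ^ k) \<noteq> 0" for x
      using that R by auto
    fix x :: "real ^ 'n"
    define P where "P = 2 powr (real (j + L) * real CARD('n) / 2) *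
      (\<Prod>b\<in>UNIV - {a}. \<psi> (G b) (2 ^ (j + L) * x $ b - of_int (m $ b))) * g x"
    have "(LINT t|lborel. wavelet \<psi> L j G m (x + t *\<^sub>R axis a 1) * (g (x + t *\<^sub>R axis a 1) *
          ((x + t *\<^sub>R axis a 1) $ a - wavelet_center L j m $ a) ^ k)) =
        (LINT t|lborel. P * (\<psi> M (2 ^ (j + L) * (x $ a + t) - of_int (m $ a)) * (x $ a + t - of_int (m $ a) / 2 ^ (j + L)) ^ k))"
      unfolding wavelet_shift[where G = G and a = a, OF G] g P_def
      by (rule Bochner_Integration.integral_cong) (auto simp: wavelet_center_def axis_def)
    also have "\<dots> = 0"
      using scaled_moment_zero[OF sys k] by simp
    finally show "(LINT t|lborel. wavelet \<psi> L j G m (x + t *\<^sub>R axis a 1) * (g (x + t *\<^sub>R axis a 1) *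
          ((x + t *\<^sub>R axis a 1) $ a - wavelet_center L j m $ a) ^ k)) = 0" .
  qed
qed

lemma wavelet_pairing_eq:
  assumes sys: "wavelet_system u \<psi>" and \<phi>: "\<phi> \<in> test_functions"
  shows "wavelet_pairing \<psi> L j G m \<phi> = (LINT x|lborel. wavelet \<psi> L j G m x * \<phi> x)"
proof -
  obtain R where R: "\<And>x. wavelet \<psi> L j G m x \<noteq> 0 \<Longrightarrow> x \<in> cball 0 R"
    by (rule wavelet_support_cball[OF sys, of L j G m]) blast
  show ?thesis
    unfolding wavelet_pairing_def per_wavelet_def
    by (rule integral_periodization[OF continuous_on_wavelet[OF sys] R])
       (use \<phi> continuous_on_iter_partial[of \<phi> UNIV "[]"] in \<open>auto simp: test_functions_def\<close>)
qed

lemma integrable_wavelet_times: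
  assumes sys: "wavelet_system u \<psi>" and g: "continuous_on UNIV g"
  shows "integrable lborel (\<lambda>x. wavelet \<psi> L j G m x * g x)"
proof -
  obtain R where R: "\<And>x. wavelet \<psi> L j G m x \<noteq> 0 \<Longrightarrow> x \<in> cball 0 R"
    by (rule wavelet_support_cball[OF sys, of L j G m]) blast
  show ?thesis
    by (rule integrable_continuous_bounded_support[where R = R])
       (use R in \<open>auto intro!: continuous_intros continuous_on_wavelet[OF sys] g\<close>)
qed

lemma wavelet_pairing_diff:
  assumes sys: "wavelet_system u \<psi>" and \<phi>: "\<phi> \<in> test_functions" and \<eta>: "\<eta> \<in> test_functions"
  shows "wavelet_pairing \<psi> L j G m (\<lambda>x. \<phi> x - \<eta> x) =
    wavelet_pairing \<psi> L j G m \<phi> - wavelet_pairing \<psi> L j G m \<eta>"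
  using continuous_on_iter_partial[OF test_functions_smooth[OF \<phi>], of UNIV "[]"]
    continuous_on_iter_partial[OF test_functions_smooth[OF \<eta>], of UNIV "[]"]
  unfolding wavelet_pairing_eq[OF sys \<phi>] wavelet_pairing_eq[OF sys \<eta>]
    wavelet_pairing_eq[OF sys test_functions_diff[OF \<phi> \<eta>]]
  by (simp add: right_diff_distrib integrable_wavelet_times[OF sys])

text \<open>The order 0 term is for the scale 0 wavelets built from \<open>\<psi> F\<close> alone,
  which offer no cancellation. For the others one coordinate direction with a factor
  \<open>\<psi> M\<close> is expanded, so pure derivatives of order \<open>u\<close> are
  enough.\<close>

definition wavelet_seminorm :: "nat \<Rightarrow> (real ^ 'n::finite \<Rightarrow> real) \<Rightarrow> real" where
  "wavelet_seminorm u \<phi> = sup_deriv [] \<phi> + (\<Sum>a\<in>UNIV. sup_deriv (replicate u a) \<phi>)"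

lemma wavelet_seminorm_nonneg: "\<phi> \<in> test_functions \<Longrightarrow> 0 \<le> wavelet_seminorm u \<phi>"
  unfolding wavelet_seminorm_def by (intro add_nonneg_nonneg sum_nonneg sup_deriv_nonneg)

text \<open>
  For \<open>G a = M\<close> the Taylor polynomial of the test function in direction \<open>a\<close> at the centre of the
  wavelet integrates to zero, so only the remainder of order \<open>u\<close> contributes.
\<close>

lemma wavelet_pairing_bound_M:
  fixes \<phi> :: "real ^ 'n::finite \<Rightarrow> real"
  assumes sys: "wavelet_system u \<psi>" and \<rho>: "\<rho> \<ge> 0" "\<forall>K x. \<psi> K x \<noteq> 0 \<longrightarrow> \<bar>x\<bar> \<le> \<rho>"
    and B: "B \<ge> 0" "\<And>K x. \<bar>\<psi> K x\<bar> \<le> B" and \<phi>: "\<phi> \<in> test_functions" and G: "G a = M"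
  shows "\<bar>wavelet_pairing \<psi> L j G m \<phi>\<bar> \<le>
    2 powr (real (j + L) * real CARD('n) / 2) * B ^ CARD('n) *
    (sup_deriv (replicate u a) \<phi> * (\<rho> / 2 ^ (j + L)) ^ u) * (2 * \<rho> / 2 ^ (j + L)) ^ CARD('n)"
proof -
  define c where "c = (wavelet_center L j m :: real ^ 'n)"
  \<comment> \<open>The base point of the expansion: \<open>x\<close> with its coordinate
    \<open>a\<close> replaced by that of the centre. The Taylor coefficients at \<open>z x\<close>
    do not change along direction \<open>a\<close>, as \<open>wavelet_moment_zero\<close>
    demands.\<close>
  define z where "z x = x - (x $ a - c $ a) *\<^sub>R axis a 1" for x :: "real ^ 'n"
  define g where "g k x = iter_partial (replicate k a) \<phi> (z x) / fact k" for k x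
  have cz: "continuous_on UNIV z" unfolding z_def by (intro continuous_intros)
  have cg: "continuous_on UNIV (g k)" for k
    unfolding g_def
    by (intro continuous_intros continuous_on_compose2[OF continuous_on_iter_partial cz]
        test_functions_smooth \<phi>) auto
  have gshift: "g k (x + t *\<^sub>R axis a 1) = g k x" for k x t
  proof -
    have "z (x + t *\<^sub>R axis a 1) = z x" by (simp add: z_def axis_def algebra_simps)
    then show ?thesis by (simp add: g_def)
  qed
  have c\<phi>: "continuous_on UNIV \<phi>"
    using continuous_on_iter_partial[OF test_functions_smooth[OF \<phi>], of UNIV "[]"] by simp
  define P where "P x = (\<Sum>k<u. g k x * (x $ a - c $ a) ^ k)" for x
  have cP: "continuous_on UNIV P" unfolding P_def by (intro continuous_intros cg)
  have "(LINT x|lborel. wavelet \<psi> L j G m x * P x) =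
      (\<Sum>k<u. (LINT x|lborel. wavelet \<psi> L j G m x * (g k x * (x $ a - c $ a) ^ k)))"
    unfolding P_def sum_distrib_left
    by (rule Bochner_Integration.integral_sum)
       (intro integrable_wavelet_times[OF sys] continuous_intros cg)
  also have "\<dots> = 0"
    unfolding c_def by (intro sum.neutral ballI wavelet_moment_zero[where G = G and a = a, OF sys _ G cg gshift]) auto
  finally have zero: "(LINT x|lborel. wavelet \<psi> L j G m x * P x) = 0" .
  have "(LINT x|lborel. wavelet \<psi> L j G m x * \<phi> x) = (LINT x|lborel. wavelet \<psi> L j G m x * (\<phi> x - P x))"
    using integrable_wavelet_times[OF sys c\<phi>, of L j G m] integrable_wavelet_times[OF sys cP, of L j G m] zero
    by (simp add: right_diff_distrib)
  then have eq: "wavelet_pairing \<psi> L j G m \<phi> = (LINT x|lborel. wavelet \<psi> L j G m x * (\<phi> x - P x))"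
    unfolding wavelet_pairing_eq[OF sys \<phi>] .
  show ?thesis unfolding eq
  proof (rule wavelet_integral_bound[OF sys \<rho> B])
    show "continuous_on UNIV (\<lambda>x. \<phi> x - P x)" by (intro continuous_intros c\<phi> cP)
    show "0 \<le> sup_deriv (replicate u a) \<phi> * (\<rho> / 2 ^ (j + L)) ^ u"
      using \<rho> by (intro mult_nonneg_nonneg sup_deriv_nonneg \<phi>) auto
    fix x assume nz: "wavelet \<psi> L j G m x \<noteq> 0"
    have "\<bar>\<phi> x - P x\<bar> = \<bar>\<phi> (z x + (x $ a - c $ a) *\<^sub>R axis a 1) -
        (\<Sum>k<u. iter_partial (replicate k a) \<phi> (z x) / fact k * (x $ a - c $ a) ^ k)\<bar>"
      by (simp add: P_def g_def z_def)
    also have "\<dots> \<le> sup_deriv (replicate u a) \<phi> * \<bar>x $ a - c $ a\<bar> ^ u"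
      by (rule Taylor_in_direction[OF \<phi>])
    also have "\<dots> \<le> sup_deriv (replicate u a) \<phi> * (\<rho> / 2 ^ (j + L)) ^ u"
      using wavelet_support[where \<psi> = \<psi>, OF \<rho>(2) nz, of a]
      by (intro mult_left_mono power_mono sup_deriv_nonneg \<phi>) (auto simp: c_def wavelet_center_def)
    finally show "\<bar>\<phi> x - P x\<bar> \<le> sup_deriv (replicate u a) \<phi> * (\<rho> / 2 ^ (j + L)) ^ u" .
  qed
qed

lemma wavelet_pairing_bound_0:
  fixes \<phi> :: "real ^ 'n::finite \<Rightarrow> real"
  assumes sys: "wavelet_system u \<psi>" and \<rho>: "\<rho> \<ge> 0" "\<forall>K x. \<psi> K x \<noteq> 0 \<longrightarrow> \<bar>x\<bar> \<le> \<rho>"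
    and B: "B \<ge> 0" "\<And>K x. \<bar>\<psi> K x\<bar> \<le> B" and \<phi>: "\<phi> \<in> test_functions"
  shows "\<bar>wavelet_pairing \<psi> L j G m \<phi>\<bar> \<le>
    2 powr (real (j + L) * real CARD('n) / 2) * B ^ CARD('n) *
    sup_deriv [] \<phi> * (2 * \<rho> / 2 ^ (j + L)) ^ CARD('n)"
  unfolding wavelet_pairing_eq[OF sys \<phi>]
proof (rule wavelet_integral_bound[OF sys \<rho> B])
  show "continuous_on UNIV \<phi>"
    using continuous_on_iter_partial[OF test_functions_smooth[OF \<phi>], of UNIV "[]"] by simp
  show "0 \<le> sup_deriv [] \<phi>" by (rule sup_deriv_nonneg[OF \<phi>])
  show "\<bar>\<phi> x\<bar> \<le> sup_deriv [] \<phi>" for x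
    using iter_partial_le_sup_deriv[OF \<phi>, of "[]"] by simp
qed

text \<open>The factor undoes the L^2 normalisation, leaving the pairing with a wavelet of sup norm
  bounded in \<open>j\<close>. It is exactly the multiplier of \<open>c j G m\<close> in
  \<open>besov_space\<close>.\<close>

definition wavelet_coeff :: "(gender \<Rightarrow> real \<Rightarrow> real) \<Rightarrow> nat \<Rightarrow> (real ^ 'n \<Rightarrow> real) \<Rightarrow>
    nat \<times> ('n::finite \<Rightarrow> gender) \<times> (int ^ 'n) \<Rightarrow> real" where
  "wavelet_coeff \<psi> L \<phi> = (\<lambda>(j, G, m).
     2 powr (- (real (j + L) * real CARD('n) / 2)) * wavelet_pairing \<psi> L j G m \<phi>)"

lemma wavelet_coeff_bound:
  assumes sys: "wavelet_system u \<psi>"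
  obtains C where "C \<ge> 0" "\<And>j G m (\<phi> :: real ^ 'n::finite \<Rightarrow> real). \<lbrakk>\<phi> \<in> test_functions; G \<in> torus_types j\<rbrakk> \<Longrightarrow>
    \<bar>wavelet_coeff \<psi> L \<phi> (j, G, m)\<bar> \<le> C * wavelet_seminorm u \<phi> * 2 powr (- (real j * (real CARD('n) + real u)))"
proof -
  obtain \<rho> where \<rho>: "\<rho> \<ge> 1" "\<forall>K x. \<psi> K x \<noteq> 0 \<longrightarrow> \<bar>x\<bar> \<le> \<rho>"
    by (rule wavelet_system_support[OF sys]) blast
  then have \<rho>0: "\<rho> \<ge> 0" by simp
  obtain B where B: "B \<ge> 0" "\<And>K x. \<bar>\<psi> K x\<bar> \<le> B"
    by (rule wavelet_system_bounded[OF sys]) blast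
  define d where "d = CARD('n)"
  define C where "C = B ^ d * \<rho> ^ u * (2 * \<rho>) ^ d"
  have "C \<ge> 0" unfolding C_def using B \<rho>0 by simp
  moreover have "\<bar>wavelet_coeff \<psi> L \<phi> (j, G, m)\<bar> \<le> C * wavelet_seminorm u \<phi> * 2 powr (- (real j * (real CARD('n) + real u)))"
    if \<phi>: "\<phi> \<in> test_functions" and G: "G \<in> torus_types j" for j G m and \<phi> :: "real ^ 'n \<Rightarrow> real"
  proof -
    define X where "X = (2::real) ^ (j + L)"
    have X: "X \<ge> 2 ^ j" "X > 0" unfolding X_def by simp_all
    define S where "S = wavelet_seminorm u \<phi>"
    have S0: "S \<ge> 0" unfolding S_def by (rule wavelet_seminorm_nonneg[OF \<phi>])
    define p where "p = 2 powr (real (j + L) * real CARD('n) / 2)"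
    have p: "p > 0" by (simp add: p_def)
    have main: "\<bar>wavelet_pairing \<psi> L j G m \<phi>\<bar> \<le> p * B ^ d * (S * (\<rho> / 2 ^ j) ^ u) * (2 * \<rho> / X) ^ d"
    proof (cases "\<exists>a. G a = M")
      case True
      then obtain a where a: "G a = M" by blast
      have "sup_deriv (replicate u a) \<phi> \<le> (\<Sum>a\<in>UNIV. sup_deriv (replicate u a) \<phi>)"
        by (rule member_le_sum) (auto intro: sup_deriv_nonneg \<phi>)
      then have s: "sup_deriv (replicate u a) \<phi> \<le> S"
        unfolding S_def wavelet_seminorm_def using sup_deriv_nonneg[OF \<phi>, of "[]"] by linarith
      have "\<bar>wavelet_pairing \<psi> L j G m \<phi>\<bar> \<le> p * B ^ d * (sup_deriv (replicate u a) \<phi> * (\<rho> / X) ^ u) * (2 * \<rho> / X) ^ d"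
        using wavelet_pairing_bound_M[where \<psi>=\<psi> and G=G, OF sys \<rho>0 \<rho>(2) B \<phi> a, of L j m] unfolding X_def p_def d_def .
      also have "\<dots> \<le> p * B ^ d * (S * (\<rho> / 2 ^ j) ^ u) * (2 * \<rho> / X) ^ d"
        using X p B \<rho>0 S0 sup_deriv_nonneg[OF \<phi>] s
        by (intro mult_right_mono mult_left_mono mult_mono power_mono divide_left_mono) auto
      finally show ?thesis .
    next
      case False
      then have "j = 0" using G by (auto simp: torus_types_def split: if_splits)
      have "(\<Sum>a\<in>UNIV. sup_deriv (replicate u a) \<phi>) \<ge> 0"
        by (intro sum_nonneg sup_deriv_nonneg \<phi>)
      then have s: "sup_deriv [] \<phi> \<le> S"
        unfolding S_def wavelet_seminorm_def by linarith
      have "1 \<le> (\<rho> / 2 ^ j) ^ u" using \<rho>(1) \<open>j = 0\<close> by (simp add: one_le_power)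
      then have s': "sup_deriv [] \<phi> \<le> S * (\<rho> / 2 ^ j) ^ u"
        using s S0 mult_left_mono[of 1 "(\<rho> / 2 ^ j) ^ u" S] by linarith
      have "\<bar>wavelet_pairing \<psi> L j G m \<phi>\<bar> \<le> p * B ^ d * sup_deriv [] \<phi> * (2 * \<rho> / X) ^ d"
        using wavelet_pairing_bound_0[where \<psi>=\<psi>, OF sys \<rho>0 \<rho>(2) B \<phi>, of L j G m] unfolding X_def p_def d_def .
      also have "\<dots> \<le> p * B ^ d * (S * (\<rho> / 2 ^ j) ^ u) * (2 * \<rho> / X) ^ d"
        using X p B \<rho>0 s' by (intro mult_right_mono mult_left_mono) auto
      finally show ?thesis .
    qed
    have "wavelet_coeff \<psi> L \<phi> (j, G, m) = inverse p * wavelet_pairing \<psi> L j G m \<phi>"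
      unfolding wavelet_coeff_def p_def powr_minus by simp
    then have "\<bar>wavelet_coeff \<psi> L \<phi> (j, G, m)\<bar> = \<bar>wavelet_pairing \<psi> L j G m \<phi>\<bar> / p"
      using p by (simp add: abs_mult divide_inverse mult.commute)
    also have "\<dots> \<le> B ^ d * (S * (\<rho> / 2 ^ j) ^ u) * (2 * \<rho> / X) ^ d"
      using main p by (simp add: pos_divide_le_eq mult_ac)
    also have "\<dots> \<le> B ^ d * (S * (\<rho> / 2 ^ j) ^ u) * (2 * \<rho> / 2 ^ j) ^ d"
      using X B \<rho>0 S0 by (intro mult_left_mono power_mono divide_left_mono) auto
    also have "\<dots> = C * S / (2 ^ j) ^ (d + u)"
      by (simp add: C_def power_divide power_add mult_ac)
    also have "(2 ^ j) ^ (d + u) = 2 powr (real j * (real CARD('n) + real u))"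
      by (simp add: powr_realpow[symmetric] powr_powr d_def power_mult[symmetric])
    finally show ?thesis by (simp add: S_def powr_minus divide_inverse)
  qed
  ultimately show thesis using that by blast
qed

section \<open>Besov sequence norms\<close>

lemma ennreal_powr_le_iff:
  assumes "r > 0" "N \<ge> 0"
  shows "ennreal_powr x (1 / r) \<le> ennreal N \<longleftrightarrow> x \<le> ennreal (N powr r)"
proof (cases x)
  case (real y)
  have "y powr (1 / r) \<le> N \<longleftrightarrow> y \<le> N powr r"
  proof
    assume "y powr (1 / r) \<le> N"
    then have "(y powr (1 / r)) powr r \<le> N powr r"
      using assms by (intro powr_mono2) auto
    then show "y \<le> N powr r" using assms real by (simp add: powr_powr)
  next
    assume "y \<le> N powr r"
    then have "y powr (1 / r) \<le> (N powr r) powr (1 / r)"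
      using assms real by (intro powr_mono2) auto
    then show "y powr (1 / r) \<le> N" using assms by (simp add: powr_powr)
  qed
  then show ?thesis using real assms by (simp add: ennreal_powr_def)
qed (simp add: ennreal_powr_def top_unique)

lemma tendsto_ennreal_powr:
  assumes f: "(f \<longlongrightarrow> x) Fi" and "x < \<infinity>" and "r > 0"
  shows "((\<lambda>n. ennreal_powr (f n) r) \<longlongrightarrow> ennreal_powr x r) Fi"
proof -
  have "((\<lambda>n. ennreal (enn2real (f n) powr r)) \<longlongrightarrow> ennreal (enn2real x powr r)) Fi"
    using assms by (intro tendsto_ennrealI tendsto_powr' tendsto_enn2real tendsto_const) auto
  moreover have "eventually (\<lambda>n. ennreal (enn2real (f n) powr r) = ennreal_powr (f n) r) Fi"
    using order_tendstoD(2)[OF f \<open>x < \<infinity>\<close>] by eventually_elim (auto simp: ennreal_powr_def)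
  ultimately have "((\<lambda>n. ennreal_powr (f n) r) \<longlongrightarrow> ennreal (enn2real x powr r)) Fi"
    by (rule Lim_transform_eventually)
  moreover have "ennreal_powr x r = ennreal (enn2real x powr r)"
    using \<open>x < \<infinity>\<close> by (auto simp: ennreal_powr_def)
  ultimately show ?thesis by simp
qed

lemma recip_infinity: "recip \<infinity> = 0"
  by (simp add: recip_def)

lemma recip_finite: "p \<noteq> \<infinity> \<Longrightarrow> 0 < p \<Longrightarrow> recip p = 1 / enn2real p \<and> 0 < enn2real p"
  by (cases p) (auto simp: recip_def divide_ennreal simp flip: ennreal_1)

lemma tendsto_SUP_finite:
  fixes f :: "'i \<Rightarrow> 'a \<Rightarrow> ennreal"
  assumes "finite A" "\<And>i. i \<in> A \<Longrightarrow> (f i \<longlongrightarrow> l i) Fi"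
  shows "((\<lambda>n. SUP i\<in>A. f i n) \<longlongrightarrow> (SUP i\<in>A. l i)) Fi"
  using assms by (induction A) (auto simp: sup_max intro!: tendsto_max)

lemma lp_norm_finite: "finite A \<Longrightarrow> lp_norm p A x < \<infinity>"
proof (cases "p = \<infinity>")
  case True
  assume "finite A"
  have "(SUP i\<in>A. ennreal (cmod (x i))) \<le> ennreal (\<Sum>i\<in>A. cmod (x i))"
    by (intro SUP_least ennreal_leI member_le_sum \<open>finite A\<close>) auto
  then show ?thesis
    using True by (simp add: lp_norm_def) (meson ennreal_less_top le_less_trans)
qed (simp add: lp_norm_def ennreal_powr_def)

lemma tendsto_lp_norm:
  assumes "finite A" and "0 < p" and "\<And>i. i \<in> A \<Longrightarrow> ((\<lambda>n. x n i) \<longlongrightarrow> y i) Fi"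
  shows "((\<lambda>n. lp_norm p A (x n)) \<longlongrightarrow> lp_norm p A y) Fi"
proof (cases "p = \<infinity>")
  case True
  then show ?thesis
    unfolding lp_norm_def using assms
    by (auto intro!: tendsto_SUP_finite tendsto_ennrealI tendsto_norm)
next
  case False
  with assms have P: "recip p > 0" "enn2real p > 0" using recip_finite by auto
  have "((\<lambda>n. ennreal_powr (\<Sum>i\<in>A. ennreal (cmod (x n i) powr enn2real p)) (recip p)) \<longlongrightarrow>
      ennreal_powr (\<Sum>i\<in>A. ennreal (cmod (y i) powr enn2real p)) (recip p)) Fi"
    using assms P
    by (intro tendsto_ennreal_powr tendsto_sum tendsto_ennrealI tendsto_powr' tendsto_norm tendsto_const) auto
  then show ?thesis using False assms(1) by (simp add: lp_norm_def)
qed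

text \<open>Hoelder's inequality for p at least 1, and the inclusion of l^p in l^1 with constant 1
  for p < 1; the maximum in the exponent joins both cases.\<close>

lemma l1_le_lp_norm:
  assumes A: "finite A" and p: "0 < p" and l: "0 \<le> l" and le: "lp_norm p A x \<le> ennreal l"
  shows "(\<Sum>i\<in>A. cmod (x i)) \<le> real (card A) powr max (1 - recip p) 0 * l"
proof (cases "p = \<infinity>")
  case True
  have "cmod (x i) \<le> l" if "i \<in> A" for i
  proof -
    have "ennreal (cmod (x i)) \<le> (SUP i\<in>A. ennreal (cmod (x i)))"
      using that by (rule SUP_upper)
    also have "\<dots> \<le> ennreal l" using le True by (simp add: lp_norm_def)
    finally show ?thesis using l by simp
  qed
  then have "(\<Sum>i\<in>A. cmod (x i)) \<le> real (card A) * l"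
    by (rule sum_bounded_above)
  then show ?thesis unfolding True recip_infinity by simp
next
  case False
  define P where "P = enn2real p"
  have P: "P > 0" "recip p = 1 / P" using recip_finite[OF False p] by (auto simp: P_def)
  have "ennreal_powr (\<Sum>i\<in>A. ennreal (cmod (x i) powr P)) (1 / P) \<le> ennreal l"
    using le False A by (simp add: lp_norm_def P_def[symmetric] P(2))
  then have "(\<Sum>i\<in>A. ennreal (cmod (x i) powr P)) \<le> ennreal (l powr P)"
    using P l by (simp add: ennreal_powr_le_iff)
  then have S: "(\<Sum>i\<in>A. cmod (x i) powr P) \<le> l powr P"
    by (simp add: sum_ennreal)
  have each: "cmod (x i) \<le> l" if "i \<in> A" for i
  proof -
    have "cmod (x i) powr P \<le> (\<Sum>i\<in>A. cmod (x i) powr P)"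
      by (rule member_le_sum[OF that _ A]) auto
    then have "cmod (x i) powr P \<le> l powr P" using S by simp
    then show ?thesis using P l by (metis norm_ge_zero not_le powr_less_mono2)
  qed
  show ?thesis
  proof (cases "l = 0 \<or> A = {}")
    case True
    then show ?thesis using each by (auto intro!: sum_nonpos)
  next
    case False
    then have l0: "l > 0" and n0: "card A > 0" using l A by (auto simp: card_gt_0_iff)
    show ?thesis
    proof (cases "P \<ge> 1")
      case True
      define n where "n = real (card A)"
      have n: "n > 0" using n0 by (simp add: n_def)
      \<comment> \<open>The common modulus of \<open>n\<close> equal entries with l^p norm
        \<open>l\<close>, the case of equality in Hoelder. Young's inequality for
        \<open>cmod (x i) / t\<close> against 1 then sums to exactly \<open>n\<close>.\<close>
      define t where "t = l * n powr (- 1 / P)"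
      have t: "t > 0" using l0 n by (simp add: t_def)
      have tP: "t powr P = l powr P / n"
      proof -
        have "t powr P = l powr P * n powr (- 1 / P * P)"
          using l0 n by (simp only: t_def powr_mult powr_powr)
        also have "n powr (- 1 / P * P) = 1 / n"
          using n P by (simp add: powr_minus divide_inverse)
        finally show ?thesis by simp
      qed
      have young: "cmod (x i) / t \<le> (1 / P) * (cmod (x i) powr P / t powr P) + (1 - 1 / P)" for i
      proof (cases "x i = 0")
        case True
        then show ?thesis using P \<open>P \<ge> 1\<close> by simp
      next
        case False
        define y where "y = cmod (x i) / t"
        have y: "y > 0" using False t by (simp add: y_def)
        have "(y powr P) powr (1 / P) * 1 powr (1 - 1 / P) \<le> (1 / P) * (y powr P) + (1 - 1 / P) * 1"
          using P(1) \<open>P \<ge> 1\<close> y by (intro Youngs_inequality_0) auto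
        then show ?thesis using P y t by (simp add: powr_powr y_def powr_divide)
      qed
      have "(\<Sum>i\<in>A. cmod (x i)) / t = (\<Sum>i\<in>A. cmod (x i) / t)"
        by (simp add: sum_divide_distrib)
      also have "\<dots> \<le> (\<Sum>i\<in>A. (1 / P) * (cmod (x i) powr P / t powr P) + (1 - 1 / P))"
        by (intro sum_mono young)
      also have "\<dots> = (1 / P) * ((\<Sum>i\<in>A. cmod (x i) powr P) / t powr P) + n * (1 - 1 / P)"
        by (simp add: sum.distrib n_def sum_distrib_left sum_divide_distrib)
      also have "\<dots> \<le> (1 / P) * (l powr P / t powr P) + n * (1 - 1 / P)"
        using S P by (intro add_right_mono mult_left_mono divide_right_mono) auto
      also have "\<dots> = n"
        using l0 n P by (simp add: tP field_simps)
      finally have "(\<Sum>i\<in>A. cmod (x i)) \<le> n * t" using t by (simp add: field_simps)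
      also have "n * t = n powr (1 - 1 / P) * l"
        using n by (simp add: t_def powr_diff powr_minus divide_inverse)
      finally show ?thesis using P \<open>P \<ge> 1\<close> by (simp add: n_def)
    next
      case False
      \<comment> \<open>The quotient is at most 1, so lowering its exponent from 1 to
        \<open>P\<close> can only increase it.\<close>
      have "cmod (x i) / l \<le> cmod (x i) powr P / l powr P" if "i \<in> A" for i
      proof (cases "x i = 0")
        case nz: False
        have "(cmod (x i) / l) powr 1 \<le> (cmod (x i) / l) powr P"
          using each[OF that] l0 False nz by (intro powr_mono') auto
        then show ?thesis using l0 by (simp add: powr_divide)
      qed simp
      then have "(\<Sum>i\<in>A. cmod (x i) / l) \<le> (\<Sum>i\<in>A. cmod (x i) powr P / l powr P)"
        by (rule sum_mono)
      also have "\<dots> = (\<Sum>i\<in>A. cmod (x i) powr P) / l powr P"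
        by (simp add: sum_divide_distrib)
      also have "\<dots> \<le> 1" using S l0 by simp
      finally have "(\<Sum>i\<in>A. cmod (x i)) \<le> l"
        using l0 by (simp add: sum_divide_distrib[symmetric])
      then show ?thesis using False P n0 by (simp add: max_def)
    qed
  qed
qed

lemma finite_torus_positions: "finite (torus_positions L j :: (int ^ 'n::finite) set)"
  and card_torus_positions: "card (torus_positions L j :: (int ^ 'n) set) = (2 ^ (j + L)) ^ CARD('n)"
proof -
  have eq: "torus_positions L j = {m :: int ^ 'n. \<forall>a. m $ a \<in> {0..<2 ^ (j + L)}}"
    by (auto simp: torus_positions_def)
  show "finite (torus_positions L j :: (int ^ 'n::finite) set)"
    unfolding eq by (rule finite_vec_set) simp
  show "card (torus_positions L j :: (int ^ 'n) set) = (2 ^ (j + L)) ^ CARD('n)"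
    unfolding eq card_vec_set by (simp add: nat_power_eq)
qed

text \<open>Besides making the sets of types finite, this makes the index type of coefficient
  sequences countable, so that functions on it form a metrizable, second countable space.\<close>

instance gender :: finite
proof
  have "(UNIV :: gender set) = {F, M}"
    using gender.exhaust by auto
  then show "finite (UNIV :: gender set)" by (metis finite.emptyI finite.insertI)
qed

lemma finite_torus_types: "finite (torus_types j :: ('n::finite \<Rightarrow> gender) set)"
  by (rule finite)

text \<open>Here, and with partial sums in the case of finite \<open>q\<close>, a norm bound is
  split into conditions that each involve only finitely many coefficients. Such conditions pass to
  pointwise limits.\<close>

lemma besov_seq_norm_le_iff_infinity:
  fixes c :: "nat \<Rightarrow> ('n::finite \<Rightarrow> gender) \<Rightarrow> int ^ 'n \<Rightarrow> complex"
  shows "besov_seq_norm L p \<infinity> \<tau> c \<le> ennreal N \<longleftrightarrow>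
    (\<forall>j. ennreal (2 powr (real j * (\<tau> - real CARD('n) * recip p))) *
       (SUP G\<in>torus_types j. lp_norm p (torus_positions L j) (c j G)) \<le> ennreal N)"
  by (simp add: besov_seq_norm_def Let_def SUP_le_iff)

lemma besov_seq_norm_le_iff_finite:
  fixes c :: "nat \<Rightarrow> ('n::finite \<Rightarrow> gender) \<Rightarrow> int ^ 'n \<Rightarrow> complex"
  assumes "0 < q" "q \<noteq> \<infinity>" "N \<ge> 0"
  shows "besov_seq_norm L p q \<tau> c \<le> ennreal N \<longleftrightarrow>
    (\<forall>J. (\<Sum>j<J. ennreal (2 powr (real j * (\<tau> - real CARD('n) * recip p) * enn2real q)) *
             (\<Sum>G\<in>torus_types j.
                ennreal_powr (lp_norm p (torus_positions L j) (c j G)) (enn2real q)))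
        \<le> ennreal (N powr enn2real q))"
  using recip_finite[OF assms(2,1)] assms
  by (simp add: besov_seq_norm_def Let_def ennreal_powr_le_iff suminf_eq_SUP SUP_le_iff)

text \<open>A Fatou property: the full norm need not be continuous, but every finite piece of it is,
  and a bound on all finite pieces is a bound on the norm.\<close>

lemma besov_seq_norm_lower_semicontinuous:
  fixes c :: "'a \<Rightarrow> nat \<Rightarrow> ('n::finite \<Rightarrow> gender) \<Rightarrow> int ^ 'n \<Rightarrow> complex"
  assumes "0 < p" "0 < q" "N \<ge> 0" and nb: "Fi \<noteq> bot"
    and le: "\<And>n. besov_seq_norm L p q \<tau> (c n) \<le> ennreal N"
    and lim: "\<And>j G m. ((\<lambda>n. c n j G m) \<longlongrightarrow> c' j G m) Fi"
  shows "besov_seq_norm L p q \<tau> c' \<le> ennreal N"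
proof (cases "q = \<infinity>")
  case True
  show ?thesis unfolding True besov_seq_norm_le_iff_infinity
  proof
    fix j
    show "ennreal (2 powr (real j * (\<tau> - real CARD('n) * recip p))) *
       (SUP G\<in>torus_types j. lp_norm p (torus_positions L j) (c' j G)) \<le> ennreal N"
    proof (rule tendsto_upperbound[OF _ _ nb])
      show "((\<lambda>n. ennreal (2 powr (real j * (\<tau> - real CARD('n) * recip p))) *
          (SUP G\<in>torus_types j. lp_norm p (torus_positions L j) (c n j G))) \<longlongrightarrow>
        ennreal (2 powr (real j * (\<tau> - real CARD('n) * recip p))) *
          (SUP G\<in>torus_types j. lp_norm p (torus_positions L j) (c' j G))) Fi"
        by (intro ennreal_tendsto_cmult tendsto_SUP_finite finite_torus_types tendsto_lp_norm
            finite_torus_positions assms lim) simp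
      show "\<forall>\<^sub>F n in Fi. ennreal (2 powr (real j * (\<tau> - real CARD('n) * recip p))) *
          (SUP G\<in>torus_types j. lp_norm p (torus_positions L j) (c n j G)) \<le> ennreal N"
        using le unfolding True besov_seq_norm_le_iff_infinity by simp
    qed
  qed
next
  case False
  have q: "enn2real q > 0" using recip_finite[OF False assms(2)] by simp
  show ?thesis unfolding besov_seq_norm_le_iff_finite[OF assms(2) False assms(3)]
  proof
    fix J
    show "(\<Sum>j<J. ennreal (2 powr (real j * (\<tau> - real CARD('n) * recip p) * enn2real q)) *
             (\<Sum>G\<in>torus_types j.
                ennreal_powr (lp_norm p (torus_positions L j) (c' j G)) (enn2real q)))
        \<le> ennreal (N powr enn2real q)"
    proof (rule tendsto_upperbound[OF _ _ nb])
      show "((\<lambda>n. \<Sum>j<J. ennreal (2 powr (real j * (\<tau> - real CARD('n) * recip p) * enn2real q)) *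
             (\<Sum>G\<in>torus_types j.
                ennreal_powr (lp_norm p (torus_positions L j) (c n j G)) (enn2real q))) \<longlongrightarrow>
         (\<Sum>j<J. ennreal (2 powr (real j * (\<tau> - real CARD('n) * recip p) * enn2real q)) *
             (\<Sum>G\<in>torus_types j.
                ennreal_powr (lp_norm p (torus_positions L j) (c' j G)) (enn2real q)))) Fi"
        by (intro tendsto_sum ennreal_tendsto_cmult tendsto_ennreal_powr tendsto_lp_norm
            finite_torus_positions assms lim lp_norm_finite q) simp
      show "\<forall>\<^sub>F n in Fi. (\<Sum>j<J. ennreal (2 powr (real j * (\<tau> - real CARD('n) * recip p) * enn2real q)) *
             (\<Sum>G\<in>torus_types j.
                ennreal_powr (lp_norm p (torus_positions L j) (c n j G)) (enn2real q)))
          \<le> ennreal (N powr enn2real q)"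
        using le unfolding besov_seq_norm_le_iff_finite[OF assms(2) False assms(3)] by simp
    qed
  qed
qed

text \<open>The embedding of \<open>b_{p,q}\<close> in \<open>b_{p,\<infinity>}\<close> with
  constant 1, read off at one level and one type: a single nonnegative summand is at most the whole
  sum.\<close>

lemma besov_seq_norm_level:
  fixes c :: "nat \<Rightarrow> ('n::finite \<Rightarrow> gender) \<Rightarrow> int ^ 'n \<Rightarrow> complex"
  assumes "0 < q" "N \<ge> 0" and le: "besov_seq_norm L p q \<tau> c \<le> ennreal N"
    and G: "G \<in> torus_types j"
  shows "lp_norm p (torus_positions L j) (c j G) \<le>
    ennreal (N * 2 powr (- (real j * (\<tau> - real CARD('n) * recip p))))"
proof -
  define e where "e = real j * (\<tau> - real CARD('n) * recip p)"
  obtain l where l: "l \<ge> 0" "lp_norm p (torus_positions L j) (c j G) = ennreal l"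
    using lp_norm_finite[OF finite_torus_positions, of p L j "c j G"]
    by (cases "lp_norm p (torus_positions L j) (c j G)") auto
  have "2 powr e * l \<le> N"
  proof (cases "q = \<infinity>")
    case True
    have "ennreal (2 powr e) * ennreal l \<le> ennreal (2 powr e) *
        (SUP G\<in>torus_types j. lp_norm p (torus_positions L j) (c j G))"
      unfolding l(2)[symmetric] by (intro mult_left_mono SUP_upper G) auto
    also have "\<dots> \<le> ennreal N"
      using le unfolding True besov_seq_norm_le_iff_infinity e_def by blast
    finally show ?thesis using assms l by (simp flip: ennreal_mult)
  next
    case False
    define Q where "Q = enn2real q"
    have Q: "Q > 0" using recip_finite[OF False assms(1)] by (simp add: Q_def)
    have "ennreal (2 powr (e * Q)) * ennreal (l powr Q) \<le> ennreal (2 powr (e * Q)) *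
        (\<Sum>G\<in>torus_types j. ennreal_powr (lp_norm p (torus_positions L j) (c j G)) Q)"
    proof (rule mult_left_mono)
      have "ennreal (l powr Q) = ennreal_powr (lp_norm p (torus_positions L j) (c j G)) Q"
        using l by (simp add: ennreal_powr_def)
      also have "\<dots> \<le> (\<Sum>G\<in>torus_types j. ennreal_powr (lp_norm p (torus_positions L j) (c j G)) Q)"
        by (rule member_le_sum[OF G _ finite_torus_types]) auto
      finally show "ennreal (l powr Q) \<le> \<dots>" .
    qed simp
    also have "\<dots> \<le> (\<Sum>j<Suc j. ennreal (2 powr (real j * (\<tau> - real CARD('n) * recip p) * Q)) *
        (\<Sum>G\<in>torus_types j. ennreal_powr (lp_norm p (torus_positions L j) (c j G)) Q))"
      unfolding e_def by (rule member_le_sum[of j "{..<Suc j}"]) auto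
    also have "\<dots> \<le> ennreal (N powr Q)"
      using le unfolding besov_seq_norm_le_iff_finite[OF assms(1) False assms(2)] Q_def by blast
    finally have "2 powr (e * Q) * l powr Q \<le> N powr Q"
      by (simp flip: ennreal_mult)
    then have "(2 powr e * l) powr Q \<le> N powr Q"
      using l by (simp add: powr_mult powr_powr)
    then show ?thesis
      using Q assms(2) l by (metis mult_nonneg_nonneg not_le powr_ge_zero powr_less_mono2)
  qed
  then have "l \<le> N * 2 powr (- e)"
    by (simp add: powr_minus field_simps)
  then show ?thesis unfolding l(2) e_def[symmetric] by (rule ennreal_leI)
qed

section \<open>The synthesis map\<close>

definition level_index :: "nat \<Rightarrow> nat \<Rightarrow> (('n::finite \<Rightarrow> gender) \<times> (int ^ 'n)) set" where
  "level_index L j = torus_types j \<times> torus_positions L j"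

lemma finite_level_index: "finite (level_index L j)"
  unfolding level_index_def by (intro finite_cartesian_product finite_torus_types finite_torus_positions)

lemma torus_index_eq_Sigma: "torus_index L = Sigma UNIV (level_index L)"
  by (auto simp: torus_index_def level_index_def)

text \<open>Coefficients off the index set vanish, which makes the balls compact for pointwise convergence.\<close>

definition besov_ball :: "nat \<Rightarrow> ennreal \<Rightarrow> ennreal \<Rightarrow> real \<Rightarrow> real \<Rightarrow>
    (nat \<times> ('n::finite \<Rightarrow> gender) \<times> (int ^ 'n) \<Rightarrow> complex) set" where
  "besov_ball L p q \<tau> N = {c. (\<forall>i. i \<notin> torus_index L \<longrightarrow> c i = 0) \<and>
     besov_seq_norm L p q \<tau> (\<lambda>j G m. c (j, G, m)) \<le> ennreal N}"

text \<open>Passing from l^p to l^1 over \<open>2^((j+L)d)\<close> positions costs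
  \<open>2^((j+L)d(1-1/p)_+)\<close>. The part depending on \<open>L\<close> goes into the constant,
  the rest is merged with the weight of the level.\<close>

lemma besov_ball_l1:
  fixes c :: "nat \<times> ('n::finite \<Rightarrow> gender) \<times> (int ^ 'n) \<Rightarrow> complex"
  assumes "0 < p" "0 < q" "N \<ge> 0" and c: "c \<in> besov_ball L p q \<tau> N" and G: "G \<in> torus_types j"
  shows "(\<Sum>m\<in>torus_positions L j. cmod (c (j, G, m))) \<le>
    2 powr (real L * real CARD('n) * max (1 - recip p) 0) * N *
    2 powr (real j * (real CARD('n) + real CARD('n) * max (recip p - 1) 0 - \<tau>))"
proof -
  define Y where "Y = max (1 - recip p) 0"
  define d where "d = real CARD('n)"
  have "lp_norm p (torus_positions L j) (\<lambda>m. c (j, G, m)) \<le>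
      ennreal (N * 2 powr (- (real j * (\<tau> - d * recip p))))"
    using besov_seq_norm_level[of q N L p \<tau> "\<lambda>j G m. c (j, G, m)" G j] assms
    by (auto simp: besov_ball_def d_def)
  then have "(\<Sum>m\<in>torus_positions L j. cmod (c (j, G, m))) \<le>
      real ((2 ^ (j + L)) ^ CARD('n)) powr Y * (N * 2 powr (- (real j * (\<tau> - d * recip p))))"
    using assms unfolding Y_def card_torus_positions[symmetric]
    by (intro l1_le_lp_norm finite_torus_positions) auto
  also have "real ((2 ^ (j + L)) ^ CARD('n)) = 2 powr (real (j + L) * d)"
    by (simp add: powr_realpow[symmetric] powr_powr d_def power_mult[symmetric])
  also have "(2 powr (real (j + L) * d)) powr Y = 2 powr (real L * d * Y) * 2 powr (real j * d * Y)"
    by (simp add: powr_powr powr_add[symmetric] algebra_simps)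
  also have "2 powr (real L * d * Y) * 2 powr (real j * d * Y) * (N * 2 powr (- (real j * (\<tau> - d * recip p)))) =
      2 powr (real L * d * Y) * N * 2 powr (real j * d * Y + - (real j * (\<tau> - d * recip p)))"
    unfolding powr_add by simp
  \<comment> \<open>The identity \<open>(1 - s)_+ = 1 - s + (s - 1)_+\<close> at
    \<open>s = recip p\<close> cancels the \<open>d/p\<close> of the Besov weight and brings out the
    threshold of the regularity assumption.\<close>
  also have "real j * d * Y + - (real j * (\<tau> - d * recip p)) = real j * (d + d * max (recip p - 1) 0 - \<tau>)"
  proof -
    have Y: "Y = 1 + max (recip p - 1) 0 - recip p" by (simp add: Y_def max_def)
    show ?thesis unfolding Y by (simp add: algebra_simps)
  qed
  finally show ?thesis by (simp add: d_def Y_def)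
qed

text \<open>Growth \<open>2^(j(d + d(1/p-1)_+ - \<tau>))\<close> of the coefficients meets decay
  \<open>2^(-j(d+u))\<close> of the pairings; the quotient is \<open>r ^ j\<close> with
  \<open>r = 2^(d(1/p-1)_+ - \<tau> - u)\<close>, and the assumption on \<open>u\<close> says that
  \<open>r < 1\<close>. The constants are uniform in \<open>N\<close>, \<open>c\<close> and
  \<phi>.\<close>

lemma besov_ball_level_bound:
  assumes sys: "wavelet_system u \<psi>" and "0 < p" "0 < q"
    and u: "real u > real CARD('n) * max (recip p - 1) 0 - \<tau>"
  obtains K r where "K \<ge> 0" "0 \<le> r" "r < 1"
    "\<And>N (c :: nat \<times> ('n::finite \<Rightarrow> gender) \<times> (int ^ 'n) \<Rightarrow> complex) \<phi> j.
       \<lbrakk>N \<ge> 0; c \<in> besov_ball L p q \<tau> N; \<phi> \<in> test_functions\<rbrakk> \<Longrightarrow>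
       (\<Sum>i\<in>level_index L j. norm (c (j, i) * of_real (wavelet_coeff \<psi> L \<phi> (j, i)))) \<le>
         K * N * wavelet_seminorm u \<phi> * r ^ j"
proof -
  obtain C where C: "C \<ge> 0" "\<And>j G m (\<phi> :: real ^ 'n \<Rightarrow> real). \<lbrakk>\<phi> \<in> test_functions; G \<in> torus_types j\<rbrakk> \<Longrightarrow>
    \<bar>wavelet_coeff \<psi> L \<phi> (j, G, m)\<bar> \<le> C * wavelet_seminorm u \<phi> * 2 powr (- (real j * (real CARD('n) + real u)))"
    by (rule wavelet_coeff_bound[OF sys, where L = L]) blast
  define d where "d = real CARD('n)"
  define e where "e = d * max (recip p - 1) 0 - \<tau> - real u"
  define r where "r = 2 powr e"
  have "e < 0" using u by (simp add: e_def d_def)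
  then have r: "0 \<le> r" "r < 1" unfolding r_def using powr_less_mono[of e 0 2] by auto
  define E where "E = 2 powr (real L * d * max (1 - recip p) 0)"
  define K where "K = real CARD('n \<Rightarrow> gender) * (C * E)"
  have "K \<ge> 0" using C by (simp add: K_def E_def)
  moreover have "(\<Sum>i\<in>level_index L j. norm (c (j, i) * of_real (wavelet_coeff \<psi> L \<phi> (j, i)))) \<le>
      K * N * wavelet_seminorm u \<phi> * r ^ j"
    if N: "N \<ge> 0" and c: "c \<in> besov_ball L p q \<tau> N" and \<phi>: "\<phi> \<in> test_functions"
    for N j and c :: "nat \<times> ('n::finite \<Rightarrow> gender) \<times> (int ^ 'n) \<Rightarrow> complex" and \<phi>
  proof -
    define S where "S = wavelet_seminorm u \<phi>"
    have S: "S \<ge> 0" unfolding S_def by (rule wavelet_seminorm_nonneg[OF \<phi>])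
    define w where "w = C * S * 2 powr (- (real j * (d + real u)))"
    have w: "w \<ge> 0" using C S by (simp add: w_def)
    have "(\<Sum>i\<in>level_index L j. norm (c (j, i) * of_real (wavelet_coeff \<psi> L \<phi> (j, i)))) =
        (\<Sum>G\<in>torus_types j. \<Sum>m\<in>torus_positions L j. cmod (c (j, G, m)) * \<bar>wavelet_coeff \<psi> L \<phi> (j, G, m)\<bar>)"
      unfolding level_index_def by (simp add: sum.cartesian_product norm_mult case_prod_unfold)
    also have "\<dots> \<le> (\<Sum>G\<in>torus_types j. \<Sum>m\<in>torus_positions L j. cmod (c (j, G, m)) * w)"
      using C(2)[OF \<phi>] by (intro sum_mono mult_left_mono) (auto simp: w_def S_def d_def)
    also have "\<dots> = (\<Sum>G\<in>torus_types j. (\<Sum>m\<in>torus_positions L j. cmod (c (j, G, m))) * w)"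
      by (simp add: sum_distrib_right)
    also have "\<dots> \<le> (\<Sum>G\<in>(torus_types j :: ('n \<Rightarrow> gender) set). (E * N * 2 powr (real j * (d + d * max (recip p - 1) 0 - \<tau>))) * w)"
      using besov_ball_l1[OF assms(2,3) N c] w
      by (intro sum_mono mult_right_mono) (auto simp: E_def d_def)
    also have "\<dots> = real (card (torus_types j :: ('n \<Rightarrow> gender) set)) *
        ((E * N * 2 powr (real j * (d + d * max (recip p - 1) 0 - \<tau>))) * w)"
      by simp
    also have "\<dots> \<le> real CARD('n \<Rightarrow> gender) * ((E * N * 2 powr (real j * (d + d * max (recip p - 1) 0 - \<tau>))) * w)"
      using N w by (intro mult_right_mono of_nat_mono card_mono) (auto simp: E_def)
    also have "\<dots> = K * N * S * (2 powr (real j * (d + d * max (recip p - 1) 0 - \<tau>)) * 2 powr (- (real j * (d + real u))))"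
      by (simp add: K_def w_def)
    also have "2 powr (real j * (d + d * max (recip p - 1) 0 - \<tau>)) * 2 powr (- (real j * (d + real u))) = r ^ j"
    proof -
      have "real j * (d + d * max (recip p - 1) 0 - \<tau>) + - (real j * (d + real u)) = e * real j"
        by (simp add: e_def algebra_simps)
      then show ?thesis
        by (simp only: powr_add[symmetric]) (simp add: r_def powr_powr[symmetric] powr_realpow)
    qed
    finally show ?thesis by (simp add: S_def)
  qed
  ultimately show thesis using that r by blast
qed

text \<open>An iterated sum, scale by scale, so that its partial sums involve finitely many
  coefficients. On the balls it agrees with the unordered sum of \<open>besov_space\<close>, by
  \<open>has_sum_synthesis\<close> below.\<close>

definition synthesis :: "(gender \<Rightarrow> real \<Rightarrow> real) \<Rightarrow> nat \<Rightarrow> (real ^ 'n::finite \<Rightarrow> real) \<Rightarrow>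
    (nat \<times> ('n \<Rightarrow> gender) \<times> (int ^ 'n) \<Rightarrow> complex) \<Rightarrow> complex" where
  "synthesis \<psi> L \<phi> c =
     (\<Sum>j. \<Sum>i\<in>level_index L j. c (j, i) * of_real (wavelet_coeff \<psi> L \<phi> (j, i)))"

text \<open>The geometric level bound does not depend on the element of the ball. It gives absolute
  summability over the index set, continuity by the Weierstrass test (partial sums are continuous in
  finitely many coordinates), and a bound by one continuous seminorm.\<close>

lemma synthesis_properties:
  fixes \<psi> L p q \<tau> u
  defines "T \<equiv> synthesis \<psi> L :: (real ^ 'n::finite \<Rightarrow> real) \<Rightarrow> _"
  assumes sys: "wavelet_system u \<psi>" and "0 < p" "0 < q"
    and u: "real u > real CARD('n) * max (recip p - 1) 0 - \<tau>" and N: "N \<ge> 0"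
  shows has_sum_synthesis: "\<And>c \<phi>. c \<in> besov_ball L p q \<tau> N \<Longrightarrow> \<phi> \<in> test_functions \<Longrightarrow>
      ((\<lambda>i. c i * of_real (wavelet_coeff \<psi> L \<phi> i)) has_sum T \<phi> c) (torus_index L)"
    and continuous_on_synthesis: "\<And>\<phi>. \<phi> \<in> test_functions \<Longrightarrow> continuous_on (besov_ball L p q \<tau> N) (T \<phi>)"
    and synthesis_bound: "\<exists>K. \<forall>c\<in>besov_ball L p q \<tau> N. \<forall>\<phi>\<in>test_functions. norm (T \<phi> c) \<le> K * wavelet_seminorm u \<phi>"
proof -
  obtain K r where K: "K \<ge> 0" and r: "0 \<le> r" "r < 1"
    and bnd: "\<And>N (c :: nat \<times> ('n::finite \<Rightarrow> gender) \<times> (int ^ 'n) \<Rightarrow> complex) \<phi> j.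
       \<lbrakk>N \<ge> 0; c \<in> besov_ball L p q \<tau> N; \<phi> \<in> test_functions\<rbrakk> \<Longrightarrow>
       (\<Sum>i\<in>level_index L j. norm (c (j, i) * of_real (wavelet_coeff \<psi> L \<phi> (j, i)))) \<le>
         K * N * wavelet_seminorm u \<phi> * r ^ j"
    by (rule besov_ball_level_bound[OF assms(2-5), where L = L]) blast
  have geo: "summable (\<lambda>j. C * r ^ j)" for C
    using r by (intro summable_mult summable_geometric) auto
  have term_bnd: "norm (\<Sum>i\<in>level_index L j. c (j, i) * of_real (wavelet_coeff \<psi> L \<phi> (j, i))) \<le>
      K * N * wavelet_seminorm u \<phi> * r ^ j" if "c \<in> besov_ball L p q \<tau> N" "\<phi> \<in> test_functions" for c j and \<phi> :: "real ^ 'n \<Rightarrow> real"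
    by (rule order_trans[OF norm_sum bnd[OF N that]])
  show "((\<lambda>i. c i * of_real (wavelet_coeff \<psi> L \<phi> i)) has_sum T \<phi> c) (torus_index L)"
    if c: "c \<in> besov_ball L p q \<tau> N" and \<phi>: "\<phi> \<in> test_functions" for c \<phi>
  proof -
    define f where "f i = c i * of_real (wavelet_coeff \<psi> L \<phi> i)" for i
    have "summable (\<lambda>j. \<Sum>i\<in>level_index L j. norm (f (j, i)))"
      by (rule summable_comparison_test'[OF geo[of "K * N * wavelet_seminorm u \<phi>"], of 0])
         (use bnd[OF N c \<phi>] in \<open>simp add: f_def sum_nonneg\<close>)
    then have "(\<lambda>j. norm (\<Sum>\<^sub>\<infinity>i\<in>level_index L j. norm (f (j, i)))) summable_on UNIV"
      by (simp add: finite_level_index summable_on_UNIV_nonneg_real_iff sum_nonneg)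
    then have "(\<lambda>i. norm (f i)) summable_on Sigma UNIV (level_index L)"
      unfolding Infinite_Sum.abs_summable_on_Sigma_iff by (simp add: finite_level_index)
    then have sf: "f summable_on Sigma UNIV (level_index L)"
      by (rule Infinite_Sum.abs_summable_summable)
    then have hs: "(f has_sum infsum f (Sigma UNIV (level_index L))) (Sigma UNIV (level_index L))"
      by (rule has_sum_infsum)
    have sj: "((\<lambda>j. \<Sum>i\<in>level_index L j. f (j, i)) has_sum infsum f (Sigma UNIV (level_index L))) UNIV"
      by (rule has_sum_SigmaD[OF hs]) (simp add: has_sum_finite finite_level_index)
    then have "T \<phi> c = infsum f (Sigma UNIV (level_index L))"
      unfolding T_def synthesis_def using has_sum_imp_sums[OF sj] by (simp add: f_def sums_iff)
    then show ?thesis using hs by (simp add: f_def[abs_def] torus_index_eq_Sigma)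
  qed
  show "continuous_on (besov_ball L p q \<tau> N) (T \<phi>)" if \<phi>: "\<phi> \<in> test_functions" for \<phi>
  proof (rule uniform_limit_theorem)
    show "uniform_limit (besov_ball L p q \<tau> N)
       (\<lambda>n c. \<Sum>j<n. \<Sum>i\<in>level_index L j. c (j, i) * of_real (wavelet_coeff \<psi> L \<phi> (j, i))) (T \<phi>) sequentially"
      unfolding T_def synthesis_def[abs_def]
      by (rule Weierstrass_m_test[OF term_bnd[OF _ \<phi>] geo])
    show "\<forall>\<^sub>F n in sequentially. continuous_on (besov_ball L p q \<tau> N)
       (\<lambda>c. \<Sum>j<n. \<Sum>i\<in>level_index L j. c (j, i) * of_real (wavelet_coeff \<psi> L \<phi> (j, i)))"
      by (intro always_eventually allI continuous_intros
          continuous_on_subset[OF continuous_on_product_coordinates subset_UNIV])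
  qed simp
  have "norm (T \<phi> c) \<le> (K * N * (\<Sum>j. r ^ j)) * wavelet_seminorm u \<phi>"
    if "c \<in> besov_ball L p q \<tau> N" "\<phi> \<in> test_functions" for c \<phi>
  proof -
    have "norm (T \<phi> c) \<le> (\<Sum>j. K * N * wavelet_seminorm u \<phi> * r ^ j)"
      unfolding T_def synthesis_def by (rule norm_suminf_le[OF term_bnd[OF that] geo])
    also have "\<dots> = K * N * wavelet_seminorm u \<phi> * (\<Sum>j. r ^ j)"
      by (rule suminf_mult) (use geo[of 1] in simp)
    finally show ?thesis by (simp add: mult_ac)
  qed
  then show "\<exists>K. \<forall>c\<in>besov_ball L p q \<tau> N. \<forall>\<phi>\<in>test_functions. norm (T \<phi> c) \<le> K * wavelet_seminorm u \<phi>"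
    by blast
qed

lemma besov_seq_norm_cong:
  assumes "\<And>j G m. G \<in> torus_types j \<Longrightarrow> m \<in> torus_positions L j \<Longrightarrow> c j G m = c' j G m"
  shows "besov_seq_norm L p q \<tau> c = besov_seq_norm L p q \<tau> c'"
proof -
  have "lp_norm p (torus_positions L j) (c j G) = lp_norm p (torus_positions L j) (c' j G)"
    if "G \<in> torus_types j" for j G
  proof -
    have "(SUP m\<in>torus_positions L j. ennreal (cmod (c j G m))) =
        (SUP m\<in>torus_positions L j. ennreal (cmod (c' j G m)))"
      by (rule SUP_cong) (use assms that in auto)
    moreover have "(\<Sum>\<^sub>\<infinity>m\<in>torus_positions L j. ennreal (cmod (c j G m) powr enn2real p)) =
        (\<Sum>\<^sub>\<infinity>m\<in>torus_positions L j. ennreal (cmod (c' j G m) powr enn2real p))"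
      by (rule infsum_cong) (use assms that in auto)
    ultimately show ?thesis by (simp add: lp_norm_def)
  qed
  then show ?thesis
    unfolding besov_seq_norm_def Let_def by (simp cong: sum.cong SUP_cong)
qed

lemma tendsto_fun_coordinate:
  fixes c :: "'a \<Rightarrow> 'b \<Rightarrow> 'c::topological_space"
  assumes "(c \<longlongrightarrow> l) Fi"
  shows "((\<lambda>n. c n i) \<longlongrightarrow> l i) Fi"
  using continuous_on_tendsto_compose[OF continuous_on_product_coordinates[of i] assms] by simp

text \<open>Tychonoff: the l^1 bound of a level bounds every coordinate, so the ball lies in a
  product of closed discs, and it is closed there by lower semicontinuity of the norm. Sequences
  suffice for closedness because the index type is countable.\<close>

lemma compact_besov_ball:
  assumes "0 < p" "0 < q" "N \<ge> 0"
  shows "compact (besov_ball L p q \<tau> N :: (nat \<times> ('n::finite \<Rightarrow> gender) \<times> (int ^ 'n) \<Rightarrow> complex) set)"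
proof -
  define R where "R = (\<lambda>i :: nat \<times> ('n \<Rightarrow> gender) \<times> (int ^ 'n).
    2 powr (real L * real CARD('n) * max (1 - recip p) 0) * N *
    2 powr (real (fst i) * (real CARD('n) + real CARD('n) * max (recip p - 1) 0 - \<tau>)))"
  define P where "P = PiE UNIV (\<lambda>i. cball (0::complex) (R i))"
  have "compactin (product_topology (\<lambda>_. euclidean) UNIV) P"
    unfolding P_def compactin_PiE by (simp add: compact_cball)
  then have "compact P"
    unfolding euclidean_product_topology compactin_euclidean_iff .
  moreover have "besov_ball L p q \<tau> N \<subseteq> P"
  proof
    fix c :: "nat \<times> ('n \<Rightarrow> gender) \<times> (int ^ 'n) \<Rightarrow> complex"
    assume c: "c \<in> besov_ball L p q \<tau> N"
    have "cmod (c (j, G, m)) \<le> R (j, G, m)" for j G m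
    proof (cases "(j, G, m) \<in> torus_index L")
      case True
      then have G: "G \<in> torus_types j" and m: "m \<in> torus_positions L j"
        by (auto simp: torus_index_def)
      have "cmod (c (j, G, m)) \<le> (\<Sum>m\<in>torus_positions L j. cmod (c (j, G, m)))"
        by (rule member_le_sum[OF m _ finite_torus_positions]) auto
      also have "\<dots> \<le> R (j, G, m)"
        unfolding R_def using besov_ball_l1[OF assms c G] by simp
      finally show ?thesis .
    next
      case False
      then have "c (j, G, m) = 0" using c by (auto simp: besov_ball_def)
      then show ?thesis using assms by (simp add: R_def)
    qed
    then show "c \<in> P" by (auto simp: P_def)
  qed
  moreover have "closed (besov_ball L p q \<tau> N :: (nat \<times> ('n \<Rightarrow> gender) \<times> (int ^ 'n) \<Rightarrow> complex) set)"
    unfolding closed_sequential_limits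
  proof (intro allI impI, elim conjE)
    fix c :: "nat \<Rightarrow> nat \<times> ('n \<Rightarrow> gender) \<times> (int ^ 'n) \<Rightarrow> complex" and l
    assume c: "\<forall>n. c n \<in> besov_ball L p q \<tau> N" and lim: "c \<longlonglongrightarrow> l"
    have "l i = 0" if "i \<notin> torus_index L" for i
    proof -
      have "(\<lambda>n. c n i) = (\<lambda>n. 0)" using c that unfolding besov_ball_def by blast
      then show ?thesis
        using tendsto_fun_coordinate[OF lim, of i] by (simp add: LIMSEQ_const_iff)
    qed
    moreover have "besov_seq_norm L p q \<tau> (\<lambda>j G m. l (j, G, m)) \<le> ennreal N"
    proof (rule besov_seq_norm_lower_semicontinuous[OF assms, of sequentially])
      show "besov_seq_norm L p q \<tau> (\<lambda>j G m. c n (j, G, m)) \<le> ennreal N" for n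
        using c by (simp add: besov_ball_def)
    qed (auto intro: tendsto_fun_coordinate lim)
    ultimately show "l \<in> besov_ball L p q \<tau> N" by (simp add: besov_ball_def)
  qed
  ultimately show ?thesis
    using compact_Int_closed by (metis inf.absorb_iff2)
qed

text \<open>Neither the norm nor the series sees coefficients off the index set, so these may be put
  to zero; a finite norm is below some natural number. This makes the space a countable union over
  balls.\<close>

lemma mem_besov_space_iff:
  assumes sys: "wavelet_system u \<psi>" and pq: "0 < p" "0 < q"
    and u: "real u > real CARD('n) * max (recip p - 1) 0 - \<tau>"
  shows "f \<in> (besov_space \<psi> L p q \<tau> :: ((real ^ 'n::finite \<Rightarrow> real) \<Rightarrow> real) set) \<longleftrightarrow>
    f \<in> gen_functions \<and> (\<exists>N. \<exists>c\<in>besov_ball L p q \<tau> (real N).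
       \<forall>\<phi>\<in>test_functions. synthesis \<psi> L \<phi> c = of_real (f \<phi>))"
proof
  assume "f \<in> besov_space \<psi> L p q \<tau>"
  then obtain c where f: "f \<in> gen_functions" and fin: "besov_seq_norm L p q \<tau> c < \<infinity>"
    and sum: "\<And>\<phi>. \<phi> \<in> test_functions \<Longrightarrow> ((\<lambda>(j, G, m). c j G m *
              of_real (2 powr (- (real (j + L) * real CARD('n) / 2)) *
                        wavelet_pairing \<psi> L j G m \<phi>))
             has_sum of_real (f \<phi>)) (torus_index L)"
    unfolding besov_space_def by blast
  define c' where "c' i = (if i \<in> torus_index L then (case i of (j, G, m) \<Rightarrow> c j G m) else 0)" for i
  obtain N where "besov_seq_norm L p q \<tau> c < of_nat N"
    using ennreal_Ex_less_of_nat[of "besov_seq_norm L p q \<tau> c"] fin by auto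
  moreover have "besov_seq_norm L p q \<tau> (\<lambda>j G m. c' (j, G, m)) = besov_seq_norm L p q \<tau> c"
    by (rule besov_seq_norm_cong) (simp add: c'_def torus_index_def)
  ultimately have c': "c' \<in> besov_ball L p q \<tau> (real N)"
    by (auto simp: besov_ball_def c'_def ennreal_of_nat_eq_real_of_nat)
  have "synthesis \<psi> L \<phi> c' = of_real (f \<phi>)" if \<phi>: "\<phi> \<in> test_functions" for \<phi>
  proof -
    have "((\<lambda>i. c' i * of_real (wavelet_coeff \<psi> L \<phi> i)) has_sum of_real (f \<phi>)) (torus_index L)"
      by (rule has_sum_cong[THEN iffD1, OF _ sum[OF \<phi>]]) (auto simp: c'_def wavelet_coeff_def)
    then show ?thesis
      using has_sum_synthesis[OF sys pq u _ c' \<phi>] has_sum_unique by auto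
  qed
  with f c' show "f \<in> gen_functions \<and> (\<exists>N. \<exists>c\<in>besov_ball L p q \<tau> (real N).
       \<forall>\<phi>\<in>test_functions. synthesis \<psi> L \<phi> c = of_real (f \<phi>))" by blast
next
  assume "f \<in> gen_functions \<and> (\<exists>N. \<exists>c\<in>besov_ball L p q \<tau> (real N).
       \<forall>\<phi>\<in>test_functions. synthesis \<psi> L \<phi> c = of_real (f \<phi>))"
  then obtain N c where f: "f \<in> gen_functions" and c: "c \<in> besov_ball L p q \<tau> (real N)"
    and eq: "\<And>\<phi>. \<phi> \<in> test_functions \<Longrightarrow> synthesis \<psi> L \<phi> c = of_real (f \<phi>)" by blast
  have "besov_seq_norm L p q \<tau> (\<lambda>j G m. c (j, G, m)) < \<infinity>"
    using c by (auto simp: besov_ball_def intro: le_less_trans)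
  moreover have "((\<lambda>(j, G, m). c (j, G, m) *
              of_real (2 powr (- (real (j + L) * real CARD('n) / 2)) *
                        wavelet_pairing \<psi> L j G m \<phi>))
             has_sum of_real (f \<phi>)) (torus_index L)" if \<phi>: "\<phi> \<in> test_functions" for \<phi>
    by (rule has_sum_cong[THEN iffD1, OF _ has_sum_synthesis[OF sys pq u of_nat_0_le_iff c \<phi>, unfolded eq[OF \<phi>]]]) (auto simp: wavelet_coeff_def)
  ultimately show "f \<in> besov_space \<psi> L p q \<tau>"
    unfolding besov_space_def using f by blast
qed

section \<open>Measurability\<close>

text \<open>Ensures that the dense set is nonempty, so that it can be enumerated by a
  sequence.\<close>

lemma zero_test_function: "(\<lambda>x :: real ^ 'n::finite. 0) \<in> test_functions"
proof -
  have "iter_partial is (\<lambda>x :: real ^ 'n. 0) = (\<lambda>x. 0)" for "is"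
    by (induction "is") (auto simp: frechet_derivative_const)
  then show ?thesis by (simp add: test_functions_def smooth_def)
qed

lemma sigma_algebra_cylindrical_field: "sigma_algebra gen_functions cylindrical_field"
  unfolding cylindrical_field_def by (rule sigma_algebra_sigma_sets) auto

lemma evaluation_in_cylindrical_field:
  assumes \<phi>: "\<phi> \<in> test_functions" and S: "S \<in> sets (borel :: real measure)"
  shows "{f \<in> gen_functions. f \<phi> \<in> S} \<in> cylindrical_field"
proof -
  define B where "B = PiE {..<1::nat} (\<lambda>_. S)"
  have B: "B \<in> sets (\<Pi>\<^sub>M i\<in>{..<1::nat}. (borel :: real measure))"
    unfolding B_def by (intro sets_PiM_I_finite S) auto
  have "{f \<in> gen_functions. f \<phi> \<in> S} = {f \<in> gen_functions. (\<lambda>i\<in>{..<1::nat}. f \<phi>) \<in> B}"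
    by (auto simp: B_def PiE_iff)
  then show ?thesis
    unfolding cylindrical_field_def
    by (intro sigma_sets.Basic CollectI exI[of _ "1::nat"] exI[of _ "\<lambda>_. \<phi>"] exI[of _ B])
       (use \<phi> B in simp)
qed

text \<open>For fixed \<open>c\<close> the synthesis is additive in the test function and bounded by
  \<open>wavelet_seminorm\<close>, a finite sum of seminorms that tend to 0. Identities on the dense
  set thereby extend to all test functions.\<close>

lemma synthesis_sequentially_continuous:
  assumes sys: "wavelet_system u \<psi>" and pq: "0 < p" "0 < q"
    and u: "real u > real CARD('n::finite) * max (recip p - 1) 0 - \<tau>" and N: "N \<ge> 0"
    and c: "c \<in> besov_ball L p q \<tau> N"
    and \<phi>: "(\<phi> :: real ^ 'n \<Rightarrow> real) \<in> test_functions" and \<eta>: "\<And>n::nat. \<eta> n \<in> test_functions"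
    and lim: "\<And>is. (\<lambda>n. sup_deriv is (\<lambda>x. \<phi> x - \<eta> n x)) \<longlonglongrightarrow> 0"
  shows "(\<lambda>n. synthesis \<psi> L (\<eta> n) c) \<longlonglongrightarrow> synthesis \<psi> L \<phi> c"
proof -
  obtain K where K: "\<And>\<phi>. \<phi> \<in> test_functions \<Longrightarrow>
      norm (synthesis \<psi> L \<phi> c) \<le> K * wavelet_seminorm u (\<phi> :: real ^ 'n \<Rightarrow> real)"
    using synthesis_bound[OF sys pq u N, of L] c by blast
  have diff: "synthesis \<psi> L (\<lambda>x. \<phi> x - \<eta> n x) c = synthesis \<psi> L \<phi> c - synthesis \<psi> L (\<eta> n) c" for n
  proof -
    have hs: "((\<lambda>i. c i * of_real (wavelet_coeff \<psi> L \<phi> i) + - 1 * (c i * of_real (wavelet_coeff \<psi> L (\<eta> n) i)))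
        has_sum synthesis \<psi> L \<phi> c + - 1 * synthesis \<psi> L (\<eta> n) c) (torus_index L)"
      by (intro has_sum_add has_sum_cmult_right has_sum_synthesis[OF sys pq u N c] \<phi> \<eta>)
    have eq: "(\<lambda>i. c i * of_real (wavelet_coeff \<psi> L \<phi> i) + - 1 * (c i * of_real (wavelet_coeff \<psi> L (\<eta> n) i))) =
        (\<lambda>i. c i * of_real (wavelet_coeff \<psi> L (\<lambda>x. \<phi> x - \<eta> n x) i))"
      by (auto simp: fun_eq_iff wavelet_coeff_def wavelet_pairing_diff[OF sys \<phi> \<eta>] algebra_simps)
    show ?thesis
      using has_sum_unique[OF has_sum_synthesis[OF sys pq u N c test_functions_diff[OF \<phi> \<eta>]] hs[unfolded eq]]
      by simp
  qed
  have "(\<lambda>n. K * wavelet_seminorm u (\<lambda>x. \<phi> x - \<eta> n x)) \<longlonglongrightarrow> K * (0 + (\<Sum>a\<in>(UNIV :: 'n set). 0))"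
    unfolding wavelet_seminorm_def by (intro tendsto_intros lim)
  then have "(\<lambda>n. K * wavelet_seminorm u (\<lambda>x. \<phi> x - \<eta> n x)) \<longlonglongrightarrow> 0" by simp
  then have "(\<lambda>n. synthesis \<psi> L \<phi> c - synthesis \<psi> L (\<eta> n) c) \<longlonglongrightarrow> 0"
    by (rule Lim_null_comparison[rotated])
       (use K[OF test_functions_diff[OF \<phi> \<eta>]] in \<open>simp add: diff\<close>)
  then have "(\<lambda>n. synthesis \<psi> L \<phi> c - (synthesis \<psi> L \<phi> c - synthesis \<psi> L (\<eta> n) c)) \<longlonglongrightarrow> synthesis \<psi> L \<phi> c - 0"
    by (intro tendsto_diff tendsto_const)
  then show ?thesis by simp
qed

theorem theorem4:
  fixes p q :: ennreal and \<tau> :: real and u L :: nat and \<psi> :: "gender \<Rightarrow> real \<Rightarrow> real"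
  assumes "0 < p" and "0 < q"
    and "wavelet_system u \<psi>"
    and "real u > max \<tau> (real CARD('n) * max (recip p - 1) 0 - \<tau>)"
    and "\<And>(G :: 'n::finite \<Rightarrow> gender) m. \<exists>a. {x. wavelet \<psi> L 0 G m x \<noteq> 0} \<subseteq> cbox a (a + 1)"
  shows "(besov_space \<psi> L p q \<tau> :: ((real ^ 'n \<Rightarrow> real) \<Rightarrow> real) set) \<in> cylindrical_field"
proof -
  note pq = assms(1,2) and sys = assms(3)
  have u: "real u > real CARD('n) * max (recip p - 1) 0 - \<tau>" using assms(4) by simp
  let ?T = "synthesis \<psi> L :: (real ^ 'n \<Rightarrow> real) \<Rightarrow> _"
  let ?ball = "\<lambda>N::nat. besov_ball L p q \<tau> (real N) :: (nat \<times> ('n \<Rightarrow> gender) \<times> (int ^ 'n) \<Rightarrow> complex) set"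
  obtain D :: "(real ^ 'n \<Rightarrow> real) set" where D: "countable D" "D \<subseteq> test_functions"
    and dense: "\<And>\<phi>. \<phi> \<in> test_functions \<Longrightarrow>
       \<exists>\<eta>. (\<forall>n::nat. \<eta> n \<in> D) \<and> (\<forall>is. (\<lambda>n. sup_deriv is (\<lambda>x. \<phi> x - \<eta> n x)) \<longlonglongrightarrow> 0)"
    by (rule test_functions_separable) blast
  have "D \<noteq> {}" using dense[OF zero_test_function] by blast
  define d where "d = from_nat_into D"
  have range_d: "range d = D" unfolding d_def by (rule range_from_nat_into) fact+
  then have d: "d i \<in> test_functions" for i using D(2) by blast
  have "\<exists>C. countable C \<and> C \<subseteq> ?ball N \<and> ?ball N \<subseteq> closure C" for N
    by (rule separable[of "?ball N"]) blast
  then obtain C where C: "\<And>N. countable (C N)" "\<And>N. C N \<subseteq> ?ball N" "\<And>N. ?ball N \<subseteq> closure (C N)"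
    by metis
  \<comment> \<open>The same \<open>c\<close> has to serve all of \<open>d 0\<close>, ...,
    \<open>d n\<close>; separate choices for each \<open>i\<close> would not produce a single limit
    sequence.\<close>
  define U where "U N n = (\<Union>c\<in>C N. \<Inter>i\<in>{..n}. {f \<in> gen_functions.
      f (d i) \<in> {y. cmod (of_real y - ?T (d i) c) < 1 / real (Suc n)}})" for N n :: nat
  interpret sigma_algebra "gen_functions :: ((real ^ 'n \<Rightarrow> real) \<Rightarrow> real) set" cylindrical_field
    by (rule sigma_algebra_cylindrical_field)
  have eq: "besov_space \<psi> L p q \<tau> = (\<Union>N. \<Inter>n. U N n)"
  proof (intro set_eqI iffI)
    fix f :: "(real ^ 'n \<Rightarrow> real) \<Rightarrow> real"
    assume "f \<in> besov_space \<psi> L p q \<tau>"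
    then obtain N c where f: "f \<in> gen_functions" and c: "c \<in> ?ball N"
      and fc: "\<And>\<phi>. \<phi> \<in> test_functions \<Longrightarrow> ?T \<phi> c = of_real (f \<phi>)"
      unfolding mem_besov_space_iff[OF sys pq u] by blast
    have "f \<in> U N n" for n
    proof -
      \<comment> \<open>All \<open>n + 1\<close> errors in one continuous function that vanishes at
        the exact coefficients \<open>c\<close>, so a nearby element of \<open>C N\<close> makes
        them small at once.\<close>
      define g where "g c' = (\<Sum>i\<le>n. cmod (of_real (f (d i)) - ?T (d i) c'))" for c'
      have "continuous_on (?ball N) g"
        unfolding g_def
        by (intro continuous_intros continuous_on_synthesis[OF sys pq u] d) simp
      moreover obtain s where s: "\<And>k. s k \<in> C N" "s \<longlonglongrightarrow> c"
        using closure_sequential[of c "C N"] subsetD[OF C(3) c] by blast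
      ultimately have "(\<lambda>k. g (s k)) \<longlonglongrightarrow> g c"
        using c subsetD[OF C(2) s(1)]
        by (intro continuous_on_tendsto_compose[of "?ball N" g s c] always_eventually allI)
      moreover have "g c = 0" unfolding g_def by (simp add: fc d)
      ultimately have "\<forall>\<^sub>F k in sequentially. g (s k) < 1 / real (Suc n)"
        by (intro order_tendstoD) auto
      then obtain k where k: "g (s k) < 1 / real (Suc n)"
        using eventually_happens' sequentially_bot by blast
      have "cmod (of_real (f (d i)) - ?T (d i) (s k)) < 1 / real (Suc n)" if "i \<le> n" for i
      proof -
        have "cmod (of_real (f (d i)) - ?T (d i) (s k)) \<le> g (s k)"
          unfolding g_def by (rule member_le_sum[of i "{..n}" "\<lambda>i. cmod (of_real (f (d i)) - ?T (d i) (s k))"]) (use that in auto)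
        then show ?thesis using k by simp
      qed
      then show "f \<in> U N n" unfolding U_def using s(1) f by blast
    qed
    then show "f \<in> (\<Union>N. \<Inter>n. U N n)" by blast
  next
    fix f :: "(real ^ 'n \<Rightarrow> real) \<Rightarrow> real"
    assume "f \<in> (\<Union>N. \<Inter>n. U N n)"
    then obtain N where N: "\<And>n. f \<in> U N n" by blast
    then have f: "f \<in> gen_functions" unfolding U_def by blast
    have "\<exists>c\<in>C N. \<forall>i\<le>n. cmod (of_real (f (d i)) - ?T (d i) c) < 1 / real (Suc n)" for n
      using N[of n] unfolding U_def by blast
    then obtain s where s: "\<And>n. s n \<in> C N"
      "\<And>n i. i \<le> n \<Longrightarrow> cmod (of_real (f (d i)) - ?T (d i) (s n)) < 1 / real (Suc n)" by metis
    have sb: "\<forall>n. s n \<in> ?ball N" using s(1) C(2) by blast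
    \<comment> \<open>The approximants get better with \<open>n\<close>. A limit point of them need
      not lie in \<open>C N\<close>, but it lies in the ball, and it turns the approximate equations
      into exact ones: for fixed \<open>i\<close>, all approximants with \<open>n \<ge> i\<close>
      are controlled at \<open>d i\<close>.\<close>
    have "seq_compact (?ball N)"
      by (intro compact_imp_seq_compact compact_besov_ball pq) simp
    then obtain c r where c: "c \<in> ?ball N" "strict_mono (r :: nat \<Rightarrow> nat)" "(s \<circ> r) \<longlonglongrightarrow> c"
      using sb by (rule seq_compactE)
    have on_D: "?T (d i) c = of_real (f (d i))" for i
    proof (rule LIMSEQ_unique)
      show "(\<lambda>n. ?T (d i) ((s \<circ> r) n)) \<longlonglongrightarrow> ?T (d i) c"
        by (rule continuous_on_tendsto_compose[OF continuous_on_synthesis[OF sys pq u _ d[of i], of "real N" L] c(3,1)])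
           (use sb in simp_all)
      have "(\<lambda>n. ?T (d i) (s n) - of_real (f (d i))) \<longlonglongrightarrow> 0"
      proof (rule Lim_null_comparison)
        show "\<forall>\<^sub>F n in sequentially. norm (?T (d i) (s n) - of_real (f (d i))) \<le> 1 / real (Suc n)"
          using eventually_ge_at_top[of i]
          by eventually_elim (use s(2) in \<open>simp add: norm_minus_commute less_imp_le\<close>)
        show "(\<lambda>n. 1 / real (Suc n)) \<longlonglongrightarrow> 0"
          using LIMSEQ_Suc[OF lim_inverse_n'] .
      qed
      then have "(\<lambda>n. ?T (d i) (s n)) \<longlonglongrightarrow> of_real (f (d i))"
        by (simp only: LIM_zero_iff)
      from LIMSEQ_subseq_LIMSEQ[OF this c(2)]
      show "(\<lambda>n. ?T (d i) ((s \<circ> r) n)) \<longlonglongrightarrow> of_real (f (d i))" by (simp add: o_def)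
    qed
    have "?T \<phi> c = of_real (f \<phi>)" if \<phi>: "\<phi> \<in> test_functions" for \<phi>
    proof -
      obtain \<eta> where \<eta>: "\<And>n::nat. \<eta> n \<in> D"
        and lim: "\<And>is. (\<lambda>n. sup_deriv is (\<lambda>x. \<phi> x - \<eta> n x)) \<longlonglongrightarrow> 0"
        using dense[OF \<phi>] by blast
      have \<eta>t: "\<eta> n \<in> test_functions" for n using \<eta> D(2) by blast
      have eq: "?T (\<eta> n) c = of_real (f (\<eta> n))" for n
        using on_D \<eta>[of n] range_d by (metis imageE)
      have "(\<lambda>n. ?T (\<eta> n) c) \<longlonglongrightarrow> ?T \<phi> c"
        by (rule synthesis_sequentially_continuous[OF sys pq u _ c(1) \<phi> \<eta>t lim]) simp
      moreover have "(\<lambda>n. ?T (\<eta> n) c) \<longlonglongrightarrow> of_real (f \<phi>)"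
        unfolding eq by (intro tendsto_of_real gen_functions_sequentially_continuous[OF f \<phi> \<eta>t lim])
      ultimately show ?thesis by (rule LIMSEQ_unique)
    qed
    then show "f \<in> besov_space \<psi> L p q \<tau>"
      unfolding mem_besov_space_iff[OF sys pq u] using f c(1) by blast
  qed
  have "U N n \<in> cylindrical_field" for N n
    unfolding U_def
  proof (intro countable_UN'' C(1) finite_INT evaluation_in_cylindrical_field d)
    fix c i
    have "open {y. cmod (of_real y - ?T (d i) c) < 1 / real (Suc n)}"
      by (intro open_Collect_less continuous_intros)
    then show "{y. cmod (of_real y - ?T (d i) c) < 1 / real (Suc n)} \<in> sets borel" by simp
  qed auto
  then show ?thesis unfolding eq
    by (intro countable_UN'' countable_INT) auto
qed

end
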